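(* Let $\mathcal{L}^\vee$ be any set of sequents in the language without $\wedge$ such that $\mathbf{ACT}^\vee \subseteq \mathcal{L}^\vee \subseteq \mathbf{ACT}_\omega^\vee$. Then $\mathcal{L}^\vee$ is undecidable. Moreover, if $\mathcal{L}^\vee$ is recursively enumerable, then it is $\Sigma_1^0$-complete.
   Context: Formulae are built from propositional variables and constants $\mathbf{0},\mathbf{1}$ using binary connectives $\cdot$, $\backslash$, $/$, $\vee$, $\wedge$ and unary ${}^*$. A sequent is $\Gamma\vdash\beta$ with $\Gamma$ a finite, possibly empty (denoted $\Lambda$), sequence of formulae and $\beta$ a formula. The calculus $\mathbf{MALC}$ has axioms $\alpha\vdash\alpha$, $\Gamma,\mathbf{0},\Delta\vdash\gamma$, $\Lambda\vdash\mathbf{1}$, and rules: from $\Gamma,\Delta\vdash\gamma$ infer $\Gamma,\mathbf{1},\Delta\vdash\gamma$; from $\Pi\vdash\alpha$ and $\Gamma,\beta,\Delta\vdash\gamma$ infer $\Gamma,\Pi,\alpha\backslash\beta,\Delta\vdash\gamma$ and also $\Gamma,\beta/\alpha,\Pi,\Delta\vdash\gamma$; from $\alpha,\Pi\vdash\beta$ infer $\Pi\vdash\alpha\backslash\beta$; from $\Pi,\alpha\vdash\beta$ infer $\Pi\vdash\beta/\alpha$; from $\Gamma,\alpha,\beta,\Delta\vdash\gamma$ infer $\Gamma,\alpha\cdot\beta,\Delta\vdash\gamma$; from $\Gamma\vdash\alpha$ and $\Delta\vdash\beta$ infer $\Gamma,\Delta\vdash\alpha\cdot\beta$; from $\Gamma,\alpha_i,\Delta\vdash\gamma$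 ($i=1,2$) infer $\Gamma,\alpha_1\wedge\alpha_2,\Delta\vdash\gamma$; from $\Pi\vdash\alpha_1$ and $\Pi\vdash\alpha_2$ infer $\Pi\vdash\alpha_1\wedge\alpha_2$; from $\Gamma,\alpha_1,\Delta\vdash\gamma$ and $\Gamma,\alpha_2,\Delta\vdash\gamma$ infer $\Gamma,\alpha_1\vee\alpha_2,\Delta\vdash\gamma$; from $\Pi\vdash\alpha_i$ ($i=1,2$) infer $\Pi\vdash\alpha_1\vee\alpha_2$. Action logic $\mathbf{ACT}$ is $\mathbf{MALC}$ extended with: from $\Lambda\vdash\beta$ and $\alpha,\beta\vdash\beta$ infer $\alpha^*\vdash\beta$; cut (from $\Pi\vdash\alpha$ and $\Gamma,\alpha,\Delta\vdash\gamma$ infer $\Gamma,\Pi,\Delta\vdash\gamma$); the axiom $\Lambda\vdash\alpha^*$; from $\Pi\vdash\alpha$ and $\Delta\vdash\alpha^*$ infer $\Pi,\Delta\vdash\alpha^*$. Infinitary action logic $\mathbf{ACT}_\omega$ is $\mathbf{MALC}$ extended with the $\omega$-rule: from $\Gamma,\alpha^n,\Delta\vdash\gamma$ for all $n\in\omega$ infer $\Gamma,\alpha^*,\Delta\vdash\gamma$ ($\alpha^n$ = $n$ consecutive copies of $\alpha$), and, for each $n\ge0$, from $\Pi_1\vdash\alpha,\dots,\Pi_n\vdash\alpha$ infer $\Pi_1,\dots,\Pi_n\vdash\alpha^*$; derivations are possibly infinite well-founded trees. $\mathbf{ACT}^\vee$ is the set of $\wedge$-free sequents derivable in the calculus obtained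 from $\mathbf{ACT}$ by deleting the two rules for $\wedge$ (i.e. the logic of action join-semilattices). $\mathbf{ACT}_\omega^\vee$ is the set of $\wedge$-free sequents derivable in $\mathbf{ACT}_\omega$ (equivalently, in $\mathbf{ACT}_\omega$ without the $\wedge$ rules; the logic of $*$-continuous action join-semilattices). Logics are sets of sequents; inclusions are set inclusions. $\Sigma_1^0$-complete means r.e. and every r.e. set is many-one reducible to it. *)

theory Defs
  imports Main "HOL-Library.Nat_Bijection"
begin

datatype form =
    Var nat
  | Zero
  | One
  | Times form form
  | LDiv form form  \<comment> \<open>\<open>LDiv \<alpha> \<beta>\<close> is \<open>\<alpha> \<setminus> \<beta>\<close>\<close>
  | RDiv form form  \<comment> \<open>\<open>RDiv \<beta> \<alpha>\<close> is \<open>\<beta> / \<alpha>\<close>\<close>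
  | Join form form
  | Meet form form
  | Star form

type_synonym sequent = "form list \<times> form"

abbreviation sequent_of :: "form list \<Rightarrow> form \<Rightarrow> sequent" (infix "\<turnstile>" 50)
  where "\<Gamma> \<turnstile> \<beta> \<equiv> (\<Gamma>, \<beta>)"

fun meet_free_form :: "form \<Rightarrow> bool" where
  "meet_free_form (Var p) \<longleftrightarrow> True"
| "meet_free_form Zero \<longleftrightarrow> True"
| "meet_free_form One \<longleftrightarrow> True"
| "meet_free_form (Times a b) \<longleftrightarrow> meet_free_form a \<and> meet_free_form b"
| "meet_free_form (LDiv a b) \<longleftrightarrow> meet_free_form a \<and> meet_free_form b"
| "meet_free_form (RDiv a b) \<longleftrightarrow> meet_free_form a \<and> meet_free_form b"
| "meet_free_form (Join a b) \<longleftrightarrow> meet_free_form a \<and> meet_free_form b"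
| "meet_free_form (Meet a b) \<longleftrightarrow> False"
| "meet_free_form (Star a) \<longleftrightarrow> meet_free_form a"

definition meet_free :: "sequent \<Rightarrow> bool" where
  "meet_free s \<longleftrightarrow> (\<forall>\<alpha> \<in> set (fst s). meet_free_form \<alpha>) \<and> meet_free_form (snd s)"

text \<open>
  A rule instance is a pair of a (possibly infinite) set of premises and a conclusion; a calculus
  is a set of rule instances. The least set closed under the rule instances consists of
  the conclusions of all well-founded, possibly infinitely branching, derivation trees.
\<close>

type_synonym calculus = "(sequent set \<times> sequent) set"

inductive derivable :: "calculus \<Rightarrow> sequent \<Rightarrow> bool" for R :: calculus where
  "(P, s) \<in> R \<Longrightarrow> (\<forall>t \<in> P. derivable R t) \<Longrightarrow> derivable R s"

inductive_set base_rules :: calculus where \<comment> \<open>\<open>MALC\<close> without the rules for \<open>\<and>\<close>\<close>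
  ax: "({}, [\<alpha>] \<turnstile> \<alpha>) \<in> base_rules"
| zeroL: "({}, \<Gamma> @ [Zero] @ \<Delta> \<turnstile> \<gamma>) \<in> base_rules"
| oneR: "({}, [] \<turnstile> One) \<in> base_rules"
| oneL: "({\<Gamma> @ \<Delta> \<turnstile> \<gamma>}, \<Gamma> @ [One] @ \<Delta> \<turnstile> \<gamma>) \<in> base_rules"
| ldivL: "({\<Pi> \<turnstile> \<alpha>, \<Gamma> @ [\<beta>] @ \<Delta> \<turnstile> \<gamma>}, \<Gamma> @ \<Pi> @ [LDiv \<alpha> \<beta>] @ \<Delta> \<turnstile> \<gamma>) \<in> base_rules"
| rdivL: "({\<Pi> \<turnstile> \<alpha>, \<Gamma> @ [\<beta>] @ \<Delta> \<turnstile> \<gamma>}, \<Gamma> @ [RDiv \<beta> \<alpha>] @ \<Pi> @ \<Delta> \<turnstile> \<gamma>) \<in> base_rules"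
| ldivR: "({[\<alpha>] @ \<Pi> \<turnstile> \<beta>}, \<Pi> \<turnstile> LDiv \<alpha> \<beta>) \<in> base_rules"
| rdivR: "({\<Pi> @ [\<alpha>] \<turnstile> \<beta>}, \<Pi> \<turnstile> RDiv \<beta> \<alpha>) \<in> base_rules"
| timesL: "({\<Gamma> @ [\<alpha>, \<beta>] @ \<Delta> \<turnstile> \<gamma>}, \<Gamma> @ [Times \<alpha> \<beta>] @ \<Delta> \<turnstile> \<gamma>) \<in> base_rules"
| timesR: "({\<Gamma> \<turnstile> \<alpha>, \<Delta> \<turnstile> \<beta>}, \<Gamma> @ \<Delta> \<turnstile> Times \<alpha> \<beta>) \<in> base_rules"
| joinL: "({\<Gamma> @ [\<alpha>\<^sub>1] @ \<Delta> \<turnstile> \<gamma>, \<Gamma> @ [\<alpha>\<^sub>2] @ \<Delta> \<turnstile> \<gamma>}, \<Gamma> @ [Join \<alpha>\<^sub>1 \<alpha>\<^sub>2] @ \<Delta> \<turnstile> \<gamma>) \<in> base_rules"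
| joinR1: "({\<Pi> \<turnstile> \<alpha>\<^sub>1}, \<Pi> \<turnstile> Join \<alpha>\<^sub>1 \<alpha>\<^sub>2) \<in> base_rules"
| joinR2: "({\<Pi> \<turnstile> \<alpha>\<^sub>2}, \<Pi> \<turnstile> Join \<alpha>\<^sub>1 \<alpha>\<^sub>2) \<in> base_rules"

inductive_set meet_rules :: calculus where
  meetL1: "({\<Gamma> @ [\<alpha>\<^sub>1] @ \<Delta> \<turnstile> \<gamma>}, \<Gamma> @ [Meet \<alpha>\<^sub>1 \<alpha>\<^sub>2] @ \<Delta> \<turnstile> \<gamma>) \<in> meet_rules"
| meetL2: "({\<Gamma> @ [\<alpha>\<^sub>2] @ \<Delta> \<turnstile> \<gamma>}, \<Gamma> @ [Meet \<alpha>\<^sub>1 \<alpha>\<^sub>2] @ \<Delta> \<turnstile> \<gamma>) \<in> meet_rules"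
| meetR: "({\<Pi> \<turnstile> \<alpha>\<^sub>1, \<Pi> \<turnstile> \<alpha>\<^sub>2}, \<Pi> \<turnstile> Meet \<alpha>\<^sub>1 \<alpha>\<^sub>2) \<in> meet_rules"

definition MALC :: calculus where "MALC = base_rules \<union> meet_rules"

inductive_set act_rules :: calculus where
  starL: "({[] \<turnstile> \<beta>, [\<alpha>, \<beta>] \<turnstile> \<beta>}, [Star \<alpha>] \<turnstile> \<beta>) \<in> act_rules"
| cut: "({\<Pi> \<turnstile> \<alpha>, \<Gamma> @ [\<alpha>] @ \<Delta> \<turnstile> \<gamma>}, \<Gamma> @ \<Pi> @ \<Delta> \<turnstile> \<gamma>) \<in> act_rules"
| starR0: "({}, [] \<turnstile> Star \<alpha>) \<in> act_rules"
| starR: "({\<Pi> \<turnstile> \<alpha>, \<Delta> \<turnstile> Star \<alpha>}, \<Pi> @ \<Delta> \<turnstile> Star \<alpha>) \<in> act_rules"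

definition ACT :: calculus where "ACT = MALC \<union> act_rules"

inductive_set omega_rules :: calculus where
  omega: "({\<Gamma> @ replicate n \<alpha> @ \<Delta> \<turnstile> \<gamma> | n. True}, \<Gamma> @ [Star \<alpha>] @ \<Delta> \<turnstile> \<gamma>) \<in> omega_rules"
| starR_n: "({\<Pi> \<turnstile> \<alpha> | \<Pi>. \<Pi> \<in> set \<Pi>s}, concat \<Pi>s \<turnstile> Star \<alpha>) \<in> omega_rules"

definition ACT\<^sub>\<omega> :: calculus where "ACT\<^sub>\<omega> = MALC \<union> omega_rules"

text \<open>\<open>base_rules \<union> act_rules\<close> is \<open>ACT\<close> with the rules for \<open>\<and>\<close> deleted.\<close>

definition ACT_join :: "sequent set" where
  "ACT_join = {s. meet_free s \<and> derivable (base_rules \<union> act_rules) s}"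

definition ACT\<^sub>\<omega>_join :: "sequent set" where
  "ACT\<^sub>\<omega>_join = {s. meet_free s \<and> derivable ACT\<^sub>\<omega> s}"

text \<open>
  Partial recursive functions on natural numbers, in Kleene's presentation. \<open>recf_eval f xs y\<close>
  means that the function denoted by \<open>f\<close> is defined on the arguments \<open>xs\<close> and has value \<open>y\<close>.
\<close>

datatype recf =
    RZero
  | RSucc
  | RProj nat
  | RComp recf "recf list"
  | RPrim recf recf
  | RMu recf

inductive recf_eval :: "recf \<Rightarrow> nat list \<Rightarrow> nat \<Rightarrow> bool" where
  zero: "recf_eval RZero xs 0"
| succ: "recf_eval RSucc [x] (Suc x)"
| proj: "i < length xs \<Longrightarrow> recf_eval (RProj i) xs (xs ! i)"
| comp: "list_all2 (\<lambda>g y. recf_eval g xs y) gs ys \<Longrightarrow> recf_eval f ys z \<Longrightarrow>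
    recf_eval (RComp f gs) xs z"
| prim_0: "recf_eval f xs y \<Longrightarrow> recf_eval (RPrim f g) (0 # xs) y"
| prim_Suc: "recf_eval (RPrim f g) (n # xs) y \<Longrightarrow> recf_eval g (n # y # xs) z \<Longrightarrow>
    recf_eval (RPrim f g) (Suc n # xs) z"
| mu: "recf_eval f (n # xs) 0 \<Longrightarrow> (\<forall>m<n. \<exists>k. recf_eval f (m # xs) (Suc k)) \<Longrightarrow>
    recf_eval (RMu f) xs n"

inductive_cases recf_eval_elims:
  "recf_eval RZero xs y" "recf_eval RSucc xs y" "recf_eval (RProj i) xs y"
  "recf_eval (RComp f gs) xs y" "recf_eval (RPrim f g) (0 # xs) y"
  "recf_eval (RPrim f g) (Suc n # xs) y" "recf_eval (RMu f) xs y"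

lemma recf_eval_deterministic: "recf_eval f xs y \<Longrightarrow> recf_eval f xs z \<Longrightarrow> y = z"
proof (induction arbitrary: z rule: recf_eval.induct)
  case (comp xs gs ys f w)
  from comp.prems obtain ys' where ys': "list_all2 (\<lambda>g y. recf_eval g xs y) gs ys'"
    and z: "recf_eval f ys' z"
    by (rule recf_eval_elims)
  have "ys = ys'"
    using comp.IH(1) ys'
    by (intro nth_equalityI) (auto simp: list_all2_conv_all_nth)
  with comp.IH(2) z show ?case by simp
next
  case (mu f n xs)
  from mu.prems have z: "recf_eval f (z # xs) 0" "\<forall>m<z. \<exists>k. recf_eval f (m # xs) (Suc k)"
    by (auto elim: recf_eval_elims)
  show ?case
    using mu.IH z by (metis linorder_neqE_nat nat.distinct(1))
next
  case (prim_Suc f g n xs y w)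
  from prim_Suc.prems obtain y' where "recf_eval (RPrim f g) (n # xs) y'"
    "recf_eval g (n # y' # xs) z"
    by (rule recf_eval_elims)
  with prim_Suc.IH show ?case by blast
next
  case (prim_0 f xs y g)
  from prim_0.prems have "recf_eval f xs z" by (rule recf_eval_elims)
  with prim_0.IH show ?case by blast
next
  case (zero xs) then show ?case by (rule recf_eval_elims) simp
next
  case (succ x) then show ?case by (rule recf_eval_elims) simp
next
  case (proj i xs) from proj.prems show ?case by (rule recf_eval_elims) simp
qed

definition computable :: "(nat \<Rightarrow> nat) \<Rightarrow> bool" where
  "computable h \<longleftrightarrow> (\<exists>f. \<forall>n. recf_eval f [n] (h n))"

definition decidable_set :: "nat set \<Rightarrow> bool" where
  "decidable_set A \<longleftrightarrow> computable (\<lambda>n. if n \<in> A then 1 else 0)"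

definition re_set :: "nat set \<Rightarrow> bool" where
  "re_set A \<longleftrightarrow> (\<exists>f. A = {n. \<exists>y. recf_eval f [n] y})"

definition many_one_reducible :: "nat set \<Rightarrow> nat set \<Rightarrow> bool" where
  "many_one_reducible A B \<longleftrightarrow> (\<exists>h. computable h \<and> (\<forall>n. n \<in> A \<longleftrightarrow> h n \<in> B))"

definition sigma1_complete_set :: "nat set \<Rightarrow> bool" where
  "sigma1_complete_set A \<longleftrightarrow> re_set A \<and> (\<forall>B. re_set B \<longrightarrow> many_one_reducible B A)"

text \<open>
  Computability notions for sets of sequents are taken along the following Goedel numbering.
  It is injective and effective: the components of a sequent can be computed from its code.
\<close>

fun form_code :: "form \<Rightarrow> nat" where
  "form_code (Var p) = prod_encode (0, p)"
| "form_code Zero = prod_encode (1, 0)"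
| "form_code One = prod_encode (2, 0)"
| "form_code (Times a b) = prod_encode (3, prod_encode (form_code a, form_code b))"
| "form_code (LDiv a b) = prod_encode (4, prod_encode (form_code a, form_code b))"
| "form_code (RDiv a b) = prod_encode (5, prod_encode (form_code a, form_code b))"
| "form_code (Join a b) = prod_encode (6, prod_encode (form_code a, form_code b))"
| "form_code (Meet a b) = prod_encode (7, prod_encode (form_code a, form_code b))"
| "form_code (Star a) = prod_encode (8, form_code a)"

definition sequent_code :: "sequent \<Rightarrow> nat" where
  "sequent_code s = prod_encode (list_encode (map form_code (fst s)), form_code (snd s))"

lemma form_code_eq_iff: "form_code a = form_code b \<longleftrightarrow> a = b"
proof (induction a arbitrary: b)
  case (Var p) show ?case by (cases b) auto
next
  case Zero show ?case by (cases b) auto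
next
  case One show ?case by (cases b) auto
next
  case (Times a1 a2) then show ?case by (cases b) auto
next
  case (LDiv a1 a2) then show ?case by (cases b) auto
next
  case (RDiv a1 a2) then show ?case by (cases b) auto
next
  case (Join a1 a2) then show ?case by (cases b) auto
next
  case (Meet a1 a2) then show ?case by (cases b) auto
next
  case (Star a) then show ?case by (cases b) auto
qed

lemma inj_sequent_code: "inj sequent_code"
proof (rule injI)
  fix s t :: sequent
  have "inj form_code" by (auto intro!: injI simp: form_code_eq_iff)
  moreover assume "sequent_code s = sequent_code t"
  ultimately show "s = t"
    by (auto simp: sequent_code_def form_code_eq_iff list_encode_eq inj_map_eq_map
        intro: prod_eqI)
qed

definition decidable :: "sequent set \<Rightarrow> bool" where
  "decidable L \<longleftrightarrow> decidable_set (sequent_code ` L)"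

definition recursively_enumerable :: "sequent set \<Rightarrow> bool" where
  "recursively_enumerable L \<longleftrightarrow> re_set (sequent_code ` L)"

definition sigma1_complete :: "sequent set \<Rightarrow> bool" where
  "sigma1_complete L \<longleftrightarrow> sigma1_complete_set (sequent_code ` L)"

end

theory Submission
  imports Defs "HOL-Library.Countable"
begin

text \<open>
  A sequent is turned into a game between a refuter and a prover about two programs \<open>p\<close> and \<open>q\<close>, run in
  alternation on the same input. The star on the left lets the refuter write a word of executed
  commands, each with its claimed branch. The prover answers by picking one check: the
  alternation, the control stack of one program, or one register of one program. Each check is
  deterministic and needs a single stack only, written to the right of the word; a letter reads the
  top symbol and rewrites it, and an inconsistency puts \<open>0\<close> on the stack. A final letter claims that
  \<open>q\<close> has halted. If \<open>p\<close> halts and \<open>q\<close> does not, then every word of some fixed length is already faulty,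
  so unfolding the star finitely often gives a derivation in \<open>ACT\<close>. If \<open>q\<close> halts and \<open>p\<close> does not, then the
  honest history is a counterexample in the languages over letters and stack symbols, which refutes
  the sequent in \<open>ACT\<^sub>\<omega>\<close>.

  Given an r.e. set \<open>L\<close> between the two logics and an r.e. set \<open>B\<close>, let \<open>p\<close> semi-decide \<open>z \<in> B\<close> and let \<open>q\<close>
  semi-decide whether the sequent of this very race belongs to \<open>L\<close>. Self-reference is obtained by passing
  the code of the program-dependent part of the sequent as an input. Then the sequent is in \<open>L\<close> iff \<open>z \<in> B\<close>.
  For decidable \<open>L\<close> the same race with \<open>p\<close> testing non-membership is contradictory.
\<close>

subsection \<open>Language models\<close>

definition conc :: "'a list set \<Rightarrow> 'a list set \<Rightarrow> 'a list set" where
  "conc A B = {u @ v | u v. u \<in> A \<and> v \<in> B}"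

lemma ball_conc: "(\<forall>w\<in>conc A B. P w) \<longleftrightarrow> (\<forall>u\<in>A. \<forall>v\<in>B. P (u @ v))"
  by (auto simp: conc_def)

lemma conc_subset_iff: "conc A B \<subseteq> C \<longleftrightarrow> (\<forall>u\<in>A. \<forall>v\<in>B. u @ v \<in> C)"
  by (auto simp: conc_def)

lemma conc_assoc: "conc (conc A B) C = conc A (conc B C)"
  unfolding conc_def by (auto; metis append.assoc)

lemma conc_Nil [simp]: "conc {[]} A = A" "conc A {[]} = A"
  by (auto simp: conc_def)

lemma conc_empty [simp]: "conc {} A = {}" "conc A {} = {}"
  by (auto simp: conc_def)

lemma conc_Un: "conc (A \<union> B) C = conc A C \<union> conc B C" "conc C (A \<union> B) = conc C A \<union> conc C B"
  by (auto simp: conc_def)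

lemma conc_mono: "A \<subseteq> A' \<Longrightarrow> B \<subseteq> B' \<Longrightarrow> conc A B \<subseteq> conc A' B'"
  by (auto simp: conc_def)

lemma concI: "u \<in> A \<Longrightarrow> v \<in> B \<Longrightarrow> u @ v \<in> conc A B"
  by (auto simp: conc_def)

text \<open>Formulae denote languages over \<open>'a\<close>, with \<open>Star\<close> as the Kleene
  star. The star is then the union of the finite powers, which is what validates the
  \<omega>-rule.\<close>

primrec sem :: "(nat \<Rightarrow> 'a list set) \<Rightarrow> form \<Rightarrow> 'a list set" where
  "sem I (Var p) = I p"
| "sem I Zero = {}"
| "sem I One = {[]}"
| "sem I (Times a b) = conc (sem I a) (sem I b)"
| "sem I (LDiv a b) = {w. conc (sem I a) {w} \<subseteq> sem I b}"
| "sem I (RDiv b a) = {w. conc {w} (sem I a) \<subseteq> sem I b}"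
| "sem I (Join a b) = sem I a \<union> sem I b"
| "sem I (Meet a b) = sem I a \<inter> sem I b"
| "sem I (Star a) = {concat ws | ws. set ws \<subseteq> sem I a}"

primrec sems :: "(nat \<Rightarrow> 'a list set) \<Rightarrow> form list \<Rightarrow> 'a list set" where
  "sems I [] = {[]}"
| "sems I (\<alpha> # \<Gamma>) = conc (sem I \<alpha>) (sems I \<Gamma>)"

lemma sems_append: "sems I (\<Gamma> @ \<Delta>) = conc (sems I \<Gamma>) (sems I \<Delta>)"
  by (induction \<Gamma>) (simp_all add: conc_assoc)

lemma conc_LDiv: "conc A {w. conc A {w} \<subseteq> B} \<subseteq> B"
  by (auto simp: conc_def)

lemma conc_RDiv: "conc {w. conc {w} A \<subseteq> B} A \<subseteq> B"
  by (auto simp: conc_def)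

lemma sems_replicate: "set ws \<subseteq> sem I \<alpha> \<Longrightarrow> concat ws \<in> sems I (replicate (length ws) \<alpha>)"
  by (induction ws) (auto intro: concI)

lemma sems_concat:
  assumes "\<And>\<Pi>. \<Pi> \<in> set \<Pi>s \<Longrightarrow> sems I \<Pi> \<subseteq> sem I \<alpha>"
  shows "sems I (concat \<Pi>s) \<subseteq> sem I (Star \<alpha>)"
  using assms
proof (induction \<Pi>s)
  case Nil
  then show ?case by (auto intro!: exI[of _ "[]"])
next
  case (Cons \<Pi> \<Pi>s)
  have "sems I \<Pi> \<subseteq> sem I \<alpha>" "sems I (concat \<Pi>s) \<subseteq> sem I (Star \<alpha>)"
    using Cons by auto
  then have "sems I (concat (\<Pi> # \<Pi>s)) \<subseteq> conc (sem I \<alpha>) (sem I (Star \<alpha>))"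
    by (simp add: sems_append conc_mono)
  also have "\<dots> \<subseteq> sem I (Star \<alpha>)"
  proof
    fix w assume "w \<in> conc (sem I \<alpha>) (sem I (Star \<alpha>))"
    then obtain u ws where "w = concat (u # ws)" "set (u # ws) \<subseteq> sem I \<alpha>"
      by (auto simp: conc_def)
    then show "w \<in> sem I (Star \<alpha>)" unfolding sem.simps by blast
  qed
  finally show ?case .
qed

definition valid :: "(nat \<Rightarrow> 'a list set) \<Rightarrow> sequent \<Rightarrow> bool" where
  "valid I s \<longleftrightarrow> sems I (fst s) \<subseteq> sem I (snd s)"

text \<open>Serves the left rules for division and meet: what the conclusion has between \<Gamma>
  and \<Delta> denotes a smaller language than its counterpart in the premise.\<close>

lemma conc_context:
  "A \<subseteq> B \<Longrightarrow> conc X (conc B Y) \<subseteq> Z \<Longrightarrow> conc X (conc A Y) \<subseteq> Z"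
  by (meson conc_mono order_refl order_trans)

lemma base_rules_valid:
  assumes "(P, \<Theta> \<turnstile> \<phi>) \<in> base_rules" "\<forall>t\<in>P. valid I t"
  shows "valid I (\<Theta> \<turnstile> \<phi>)"
  using assms(1)
proof cases
  case (ldivL \<Pi> \<alpha> \<Gamma> \<beta> \<Delta>)
  then have "sems I \<Pi> \<subseteq> sem I \<alpha>" and *: "conc (sems I \<Gamma>) (conc (sem I \<beta>) (sems I \<Delta>)) \<subseteq> sem I \<phi>"
    using assms(2) by (auto simp: valid_def sems_append)
  then have "conc (sems I \<Pi>) (sem I (LDiv \<alpha> \<beta>)) \<subseteq> sem I \<beta>"
    unfolding sem.simps using conc_LDiv conc_mono by blast
  from conc_context[OF this *] show ?thesis
    unfolding ldivL valid_def by (simp add: sems_append conc_assoc)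
next
  case (rdivL \<Pi> \<alpha> \<Gamma> \<beta> \<Delta>)
  then have "sems I \<Pi> \<subseteq> sem I \<alpha>" and *: "conc (sems I \<Gamma>) (conc (sem I \<beta>) (sems I \<Delta>)) \<subseteq> sem I \<phi>"
    using assms(2) by (auto simp: valid_def sems_append)
  then have "conc (sem I (RDiv \<beta> \<alpha>)) (sems I \<Pi>) \<subseteq> sem I \<beta>"
    unfolding sem.simps using conc_RDiv conc_mono by blast
  from conc_context[OF this *] show ?thesis
    unfolding rdivL valid_def by (simp add: sems_append conc_assoc)
next
  case (ldivR \<alpha> \<beta>)
  then show ?thesis using assms(2) by (force simp: valid_def conc_def)
next
  case (rdivR \<alpha> \<beta>)
  then show ?thesis using assms(2) by (force simp: valid_def sems_append conc_def)
next
  case (timesR \<Gamma> \<alpha> \<Delta> \<beta>)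
  then show ?thesis using assms(2) by (simp add: valid_def sems_append conc_mono)
qed (use assms(2) in \<open>auto simp: valid_def sems_append conc_assoc conc_Un\<close>)

lemma meet_rules_valid:
  assumes "(P, \<Theta> \<turnstile> \<phi>) \<in> meet_rules" "\<forall>t\<in>P. valid I t"
  shows "valid I (\<Theta> \<turnstile> \<phi>)"
  using assms(1)
proof cases
  case (meetL1 \<Gamma> \<alpha>\<^sub>1 \<Delta> \<alpha>\<^sub>2)
  then show ?thesis
    using assms(2) conc_context[of "sem I \<alpha>\<^sub>1 \<inter> sem I \<alpha>\<^sub>2" "sem I \<alpha>\<^sub>1"]
    by (simp add: valid_def sems_append)
next
  case (meetL2 \<Gamma> \<alpha>\<^sub>2 \<Delta> \<alpha>\<^sub>1)
  then show ?thesis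
    using assms(2) conc_context[of "sem I \<alpha>\<^sub>1 \<inter> sem I \<alpha>\<^sub>2" "sem I \<alpha>\<^sub>2"]
    by (simp add: valid_def sems_append)
qed (use assms(2) in \<open>auto simp: valid_def\<close>)

lemma omega_rules_valid:
  assumes "(P, \<Theta> \<turnstile> \<phi>) \<in> omega_rules" "\<forall>t\<in>P. valid I t"
  shows "valid I (\<Theta> \<turnstile> \<phi>)"
  using assms(1)
proof cases
  case (omega \<Gamma> \<alpha> \<Delta>)
  have n: "conc (sems I \<Gamma>) (conc (sems I (replicate n \<alpha>)) (sems I \<Delta>)) \<subseteq> sem I \<phi>" for n
    using assms(2) omega by (force simp: valid_def sems_append)
  have "conc (sems I \<Gamma>) (conc (sem I (Star \<alpha>)) (sems I \<Delta>)) \<subseteq> sem I \<phi>"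
  proof
    fix w assume "w \<in> conc (sems I \<Gamma>) (conc (sem I (Star \<alpha>)) (sems I \<Delta>))"
    then obtain u ws v where "w = u @ concat ws @ v" "u \<in> sems I \<Gamma>" "v \<in> sems I \<Delta>"
      "set ws \<subseteq> sem I \<alpha>" by (auto simp: conc_def)
    \<comment> \<open>The premise with \<open>n = length ws\<close> covers this word.\<close>
    then show "w \<in> sem I \<phi>"
      using n[of "length ws"] sems_replicate[of ws I \<alpha>] by (auto intro: concI)
  qed
  then show ?thesis by (simp add: omega valid_def sems_append)
next
  case (starR_n \<alpha> \<Pi>s)
  then show ?thesis
    using assms(2) sems_concat[of \<Pi>s I \<alpha>] by (auto simp: valid_def simp del: sem.simps)
qed

text \<open>\<open>ACT\<^sub>\<omega>_join\<close> is defined through the full calculus, so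
  soundness has to cover the rules for \<open>Meet\<close>, read as intersection.\<close>

lemma ACT\<^sub>\<omega>_sound: "derivable ACT\<^sub>\<omega> s \<Longrightarrow> valid I s"
proof (induction rule: derivable.induct)
  case (1 P s)
  then have "\<forall>t\<in>P. valid I t" by blast
  then show ?case
    using 1(1) base_rules_valid meet_rules_valid omega_rules_valid
    unfolding ACT\<^sub>\<omega>_def MALC_def by (cases s) blast
qed

subsection \<open>Derivations in action logic\<close>

abbreviation provable :: "form list \<Rightarrow> form \<Rightarrow> bool" (infix "\<tturnstile>" 50) where
  "\<Gamma> \<tturnstile> \<gamma> \<equiv> derivable (base_rules \<union> act_rules) (\<Gamma> \<turnstile> \<gamma>)"

lemma provable_base:
  "(P, (\<Gamma>, \<gamma>)) \<in> base_rules \<Longrightarrow> (\<And>\<Delta> \<delta>. (\<Delta>, \<delta>) \<in> P \<Longrightarrow> \<Delta> \<tturnstile> \<delta>) \<Longrightarrow> \<Gamma> \<tturnstile> \<gamma>"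
  by (rule derivable.intros[of P]) auto

lemma provable_act:
  "(P, (\<Gamma>, \<gamma>)) \<in> act_rules \<Longrightarrow> (\<And>\<Delta> \<delta>. (\<Delta>, \<delta>) \<in> P \<Longrightarrow> \<Delta> \<tturnstile> \<delta>) \<Longrightarrow> \<Gamma> \<tturnstile> \<gamma>"
  by (rule derivable.intros[of P]) auto

lemma provable_ax: "[\<alpha>] \<tturnstile> \<alpha>"
  by (rule provable_base[OF base_rules.ax]) simp

lemma provable_zeroL: "\<Gamma> @ Zero # \<Delta> \<tturnstile> \<gamma>"
  using provable_base[OF base_rules.zeroL] by simp

lemma provable_rdivL: "\<Pi> \<tturnstile> \<alpha> \<Longrightarrow> RDiv \<beta> \<alpha> # \<Pi> \<tturnstile> \<beta>"
  using provable_base[OF base_rules.rdivL[of \<Pi> \<alpha> "[]" \<beta> "[]" \<beta>]] provable_ax[of \<beta>] by auto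

lemma provable_rdivR: "\<Pi> @ [\<alpha>] \<tturnstile> \<beta> \<Longrightarrow> \<Pi> \<tturnstile> RDiv \<beta> \<alpha>"
  by (rule provable_base[OF base_rules.rdivR]) auto

lemma provable_timesL: "\<Gamma> @ \<alpha> # \<beta> # \<Delta> \<tturnstile> \<gamma> \<Longrightarrow> \<Gamma> @ Times \<alpha> \<beta> # \<Delta> \<tturnstile> \<gamma>"
  using provable_base[OF base_rules.timesL[of \<Gamma> \<alpha> \<beta> \<Delta> \<gamma>]] by simp

lemma provable_timesR: "\<Gamma> \<tturnstile> \<alpha> \<Longrightarrow> \<Delta> \<tturnstile> \<beta> \<Longrightarrow> \<Gamma> @ \<Delta> \<tturnstile> Times \<alpha> \<beta>"
  by (rule provable_base[OF base_rules.timesR]) auto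

lemma provable_joinL:
  "\<Gamma> @ \<alpha> # \<Delta> \<tturnstile> \<gamma> \<Longrightarrow> \<Gamma> @ \<beta> # \<Delta> \<tturnstile> \<gamma> \<Longrightarrow> \<Gamma> @ Join \<alpha> \<beta> # \<Delta> \<tturnstile> \<gamma>"
  using provable_base[OF base_rules.joinL[of \<Gamma> \<alpha> \<Delta> \<gamma> \<beta>]] by auto

lemma provable_joinR1: "\<Pi> \<tturnstile> \<alpha> \<Longrightarrow> \<Pi> \<tturnstile> Join \<alpha> \<beta>"
  by (rule provable_base[OF base_rules.joinR1]) auto

lemma provable_joinR2: "\<Pi> \<tturnstile> \<beta> \<Longrightarrow> \<Pi> \<tturnstile> Join \<alpha> \<beta>"
  by (rule provable_base[OF base_rules.joinR2]) auto

lemma provable_oneL: "\<Gamma> @ \<Delta> \<tturnstile> \<gamma> \<Longrightarrow> \<Gamma> @ One # \<Delta> \<tturnstile> \<gamma>"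
  using provable_base[OF base_rules.oneL[of \<Gamma> \<Delta> \<gamma>]] by simp

lemma provable_oneR: "[] \<tturnstile> One"
  by (rule provable_base[OF base_rules.oneR]) simp

lemma provable_starL: "[] \<tturnstile> \<beta> \<Longrightarrow> [\<alpha>, \<beta>] \<tturnstile> \<beta> \<Longrightarrow> [Star \<alpha>] \<tturnstile> \<beta>"
  by (rule provable_act[OF act_rules.starL]) auto

lemma provable_cut: "\<Pi> \<tturnstile> \<alpha> \<Longrightarrow> \<Gamma> @ \<alpha> # \<Delta> \<tturnstile> \<gamma> \<Longrightarrow> \<Gamma> @ \<Pi> @ \<Delta> \<tturnstile> \<gamma>"
  by (rule provable_act[OF act_rules.cut[of \<Pi> \<alpha> \<Gamma> \<Delta> \<gamma>]]) auto

lemma provable_starR0: "[] \<tturnstile> Star \<alpha>"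
  by (rule provable_act[OF act_rules.starR0]) auto

lemma provable_starR: "\<Pi> \<tturnstile> \<alpha> \<Longrightarrow> \<Delta> \<tturnstile> Star \<alpha> \<Longrightarrow> \<Pi> @ \<Delta> \<tturnstile> Star \<alpha>"
  by (rule provable_act[OF act_rules.starR]) auto

text \<open>The left star rule of \<open>ACT\<close> has no side formulae, so it cannot unfold a
  star in place. Taking the right-hand side itself as the invariant of that rule yields the
  unfolding, which a cut can then carry into any context.\<close>

lemma provable_star_unfold: "[Star \<alpha>] \<tturnstile> Join One (Times \<alpha> (Star \<alpha>))"
proof (rule provable_starL)
  let ?\<beta> = "Join One (Times \<alpha> (Star \<alpha>))"
  show "[] \<tturnstile> ?\<beta>"
    by (intro provable_joinR1 provable_oneR)
  \<comment> \<open>Both parts of the invariant entail \<open>Star \<alpha>\<close>, so a further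
    \<alpha> in front leads to its second part.\<close>
  have step: "\<Delta> \<tturnstile> Star \<alpha> \<Longrightarrow> \<alpha> # \<Delta> \<tturnstile> ?\<beta>" for \<Delta>
    using provable_joinR2[OF provable_timesR[OF provable_ax]] by simp
  have "[\<alpha>] @ [One] \<tturnstile> ?\<beta>"
    by (rule provable_oneL) (simp add: step provable_starR0)
  moreover have "[\<alpha>] @ [Times \<alpha> (Star \<alpha>)] \<tturnstile> ?\<beta>"
    using provable_starR[OF provable_ax provable_ax, of \<alpha>] by (intro provable_timesL) (simp add: step)
  ultimately show "[\<alpha>, ?\<beta>] \<tturnstile> ?\<beta>"
    using provable_joinL[of "[\<alpha>]" One "[]"] by simp
qed

lemma provable_star_split:
  assumes "\<Gamma> @ \<Delta> \<tturnstile> \<gamma>" "\<Gamma> @ \<alpha> # Star \<alpha> # \<Delta> \<tturnstile> \<gamma>"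
  shows "\<Gamma> @ Star \<alpha> # \<Delta> \<tturnstile> \<gamma>"
  using provable_cut[OF provable_star_unfold, of \<Gamma> \<alpha> \<Delta> \<gamma>]
    provable_joinL[OF provable_oneL provable_timesL] assms by simp

section \<open>Iterated joins and residuals\<close>

abbreviation joins :: "form list \<Rightarrow> form \<Rightarrow> form" where
  "joins \<equiv> foldr Join"

lemma provable_joinsL:
  assumes "\<And>\<alpha>. \<alpha> \<in> set \<alpha>s \<Longrightarrow> \<Gamma> @ \<alpha> # \<Delta> \<tturnstile> \<gamma>"
  shows "\<Gamma> @ joins \<alpha>s Zero # \<Delta> \<tturnstile> \<gamma>"
  using assms by (induction \<alpha>s) (simp_all add: provable_zeroL provable_joinL)

lemma provable_joinsR: "\<alpha> \<in> set \<alpha>s \<Longrightarrow> \<Gamma> \<tturnstile> \<alpha> \<Longrightarrow> \<Gamma> \<tturnstile> joins \<alpha>s \<beta>"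
  by (induction \<alpha>s) (auto intro: provable_joinR1 provable_joinR2)

lemma sem_joins: "sem I (joins \<alpha>s \<beta>) = (\<Union>\<alpha>\<in>set \<alpha>s. sem I \<alpha>) \<union> sem I \<beta>"
  by (induction \<alpha>s) auto

lemma meet_free_joins:
  "meet_free_form (joins \<alpha>s \<beta>) \<longleftrightarrow> (\<forall>\<alpha>\<in>set \<alpha>s. meet_free_form \<alpha>) \<and> meet_free_form \<beta>"
  by (induction \<alpha>s) auto

text \<open>The outermost division takes the first formula, so that the denominators are appended on
  the right in reading order.\<close>

primrec rdivs :: "form \<Rightarrow> form list \<Rightarrow> form" where
  "rdivs \<beta> [] = \<beta>"
| "rdivs \<beta> (\<alpha> # \<alpha>s) = RDiv (rdivs \<beta> \<alpha>s) \<alpha>"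

lemma provable_rdivsR: "\<Gamma> @ \<alpha>s \<tturnstile> \<beta> \<Longrightarrow> \<Gamma> \<tturnstile> rdivs \<beta> \<alpha>s"
  by (induction \<alpha>s arbitrary: \<Gamma>) (auto intro!: provable_rdivR)

lemma sem_rdivs: "w \<in> sem I (rdivs \<beta> \<alpha>s) \<longleftrightarrow> (\<forall>v\<in>sems I \<alpha>s. w @ v \<in> sem I \<beta>)"
  by (induction \<alpha>s arbitrary: w) (simp_all add: conc_subset_iff ball_conc)

lemma meet_free_rdivs:
  "meet_free_form (rdivs \<beta> \<alpha>s) \<longleftrightarrow> (\<forall>\<alpha>\<in>set \<alpha>s. meet_free_form \<alpha>) \<and> meet_free_form \<beta>"
  by (induction \<alpha>s) auto

subsection \<open>Stack games\<close>

text \<open>The prover's winning condition for a single check. Letters are read from the left and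
  the top of the stack is the last element. A fault wins at once; running out of letters or reaching
  an empty stack never wins.\<close>

inductive wins :: "('l \<Rightarrow> 's \<Rightarrow> 's list option) \<Rightarrow> 'l list \<Rightarrow> 's list \<Rightarrow> bool"
  for \<delta> :: "'l \<Rightarrow> 's \<Rightarrow> 's list option" where
  fault: "\<delta> a t = None \<Longrightarrow> wins \<delta> (a # w) (s @ [t])"
| move: "\<delta> a t = Some v \<Longrightarrow> wins \<delta> w (s @ v) \<Longrightarrow> wins \<delta> (a # w) (s @ [t])"

lemma wins_Nil [simp]: "\<not> wins \<delta> [] s"
  by (auto elim: wins.cases)

lemma wins_Cons_snoc:
  "wins \<delta> (a # w) (s @ [t]) \<longleftrightarrow> (case \<delta> a t of None \<Rightarrow> True | Some v \<Rightarrow> wins \<delta> w (s @ v))"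
proof
  assume "wins \<delta> (a # w) (s @ [t])"
  then show "case \<delta> a t of None \<Rightarrow> True | Some v \<Rightarrow> wins \<delta> w (s @ v)"
    by cases auto
qed (auto split: option.splits intro: wins.intros)

text \<open>Variable 0 is kept for \<open>answer\<close>, hence the shift.\<close>

definition stack_var :: "'s::countable \<Rightarrow> form" where
  "stack_var t = Var (Suc (to_nat t))"

text \<open>A fault becomes \<open>Zero\<close>, which turns every sequent with it on the left into
  an axiom.\<close>

primrec pushed :: "'s::countable list option \<Rightarrow> form list" where
  "pushed None = [Zero]"
| "pushed (Some v) = map stack_var v"

abbreviation answer :: form where "answer \<equiv> Var 0"

text \<open>
  For the letter \<open>b / \<Squnion>\<^sub>t (b / \<delta>(t)) \<cdot> t\<close> at the left end and the stack at the right end, the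
  sequent \<open>a, \<Gamma>, t \<turnstile> b\<close> reduces to \<open>\<Gamma>, \<delta>(t) \<turnstile> b\<close>. The joins in a denominator act as the missing meets.
\<close>

definition letter_form ::
  "('l \<Rightarrow> 's::countable \<Rightarrow> 's list option) \<Rightarrow> 's list \<Rightarrow> 'l \<Rightarrow> form" where
  "letter_form \<delta> T a =
    RDiv answer (joins (map (\<lambda>t. Times (rdivs answer (pushed (\<delta> a t))) (stack_var t)) T) Zero)"

definition goal :: "'s::countable list \<Rightarrow> form" where
  "goal s = rdivs answer (map stack_var s)"

text \<open>\<open>T\<close> lists the symbols that a letter may meet, since a letter formula needs
  a finite join over them. The join over \<open>S\<close> on the right is the prover's choice of an
  initial stack.\<close>

definition game_sequent :: "('l \<Rightarrow> 's::countable \<Rightarrow> 's list option) \<Rightarrow> 's list \<Rightarrow> 'l list \<Rightarrow> 'l \<Rightarrow>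
    's list list \<Rightarrow> sequent" where
  "game_sequent \<delta> T A e S =
    ([Star (joins (map (letter_form \<delta> T) A) Zero), letter_form \<delta> T e] \<turnstile> joins (map goal S) Zero)"

lemma meet_free_game_sequent: "meet_free (game_sequent \<delta> T A e S)"
proof -
  have "meet_free_form (rdivs answer (pushed v))" for v :: "'s::countable list option"
    by (cases v) (auto simp: meet_free_rdivs stack_var_def)
  then show ?thesis
    by (auto simp: meet_free_def game_sequent_def letter_form_def goal_def meet_free_joins
        meet_free_rdivs stack_var_def)
qed

text \<open>One move read backwards: the division rule for the letter, then the summand of its
  denominator that matches the top symbol.\<close>

lemma provable_letter:
  assumes "t \<in> set T" "\<Gamma> @ pushed (\<delta> a t) \<tturnstile> answer"
  shows "letter_form \<delta> T a # \<Gamma> @ [stack_var t] \<tturnstile> answer"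
proof -
  have "\<Gamma> @ [stack_var t] \<tturnstile> Times (rdivs answer (pushed (\<delta> a t))) (stack_var t)"
    using assms(2) by (intro provable_timesR provable_ax provable_rdivsR)
  then show ?thesis
    unfolding letter_form_def using assms(1)
    by (auto intro!: provable_rdivL provable_joinsR[of "Times _ _"])
qed

text \<open>A move consumes the leftmost letter and rewrites the right end, so nothing in between
  matters. \<Delta> stands for what the game has not read, such as the remaining star and the final
  letter.\<close>

lemma wins_provable:
  assumes "wins \<delta> w s" "set s \<subseteq> set T"
    and "\<And>a t v. \<delta> a t = Some v \<Longrightarrow> a \<in> set w \<Longrightarrow> t \<in> set T \<Longrightarrow> set v \<subseteq> set T"
  shows "map (letter_form \<delta> T) w @ \<Delta> @ map stack_var s \<tturnstile> answer"
  using assms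
proof (induction rule: wins.induct)
  case (fault a t w s)
  then show ?case
    using provable_letter[of t T "map (letter_form \<delta> T) w @ \<Delta> @ map stack_var s" \<delta> a]
      provable_zeroL[of "map (letter_form \<delta> T) w @ \<Delta> @ map stack_var s" "[]"] by simp
next
  case (move a t v w s)
  have "set (s @ v) \<subseteq> set T"
    using move.prems move.hyps(1) by force
  then have "map (letter_form \<delta> T) w @ \<Delta> @ map stack_var (s @ v) \<tturnstile> answer"
    using move.prems by (intro move.IH) auto
  then show ?case
    using provable_letter[of t T "map (letter_form \<delta> T) w @ \<Delta> @ map stack_var s" \<delta> a]
      move.hyps(1) move.prems(1) by simp
qed

text \<open>Finitely many unfoldings suffice: after \<open>N\<close> letters the prefix alone is
  lost for the refuter, whatever the star still adds, and a word that stops earlier is beaten once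
  \<open>e\<close> closes it.\<close>

lemma game_sequent_provable:
  fixes \<delta> :: "'l \<Rightarrow> 's::countable \<Rightarrow> 's list option"
  assumes closed: "\<And>a t v. \<delta> a t = Some v \<Longrightarrow> a \<in> insert e (set A) \<Longrightarrow> t \<in> set T \<Longrightarrow> set v \<subseteq> set T"
    and S: "\<And>s. s \<in> set S \<Longrightarrow> set s \<subseteq> set T"
    and long: "\<And>w. set w \<subseteq> set A \<Longrightarrow> length w = N \<Longrightarrow> \<exists>s\<in>set S. wins \<delta> w s"
    and ended: "\<And>w. set w \<subseteq> set A \<Longrightarrow> \<exists>s\<in>set S. wins \<delta> (w @ [e]) s"
  shows "derivable (base_rules \<union> act_rules) (game_sequent \<delta> T A e S)"
proof -
  let ?X = "letter_form \<delta> T" and ?G = "joins (map goal S) Zero"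
  let ?\<alpha> = "joins (map ?X A) Zero"
  have win: "map ?X w @ \<Delta> \<tturnstile> ?G"
    if "s \<in> set S" "wins \<delta> w s" "set w \<subseteq> insert e (set A)" for w s \<Delta>
  proof -
    have "map ?X w @ \<Delta> @ map stack_var s \<tturnstile> answer"
      using that S by (intro wins_provable) (auto dest: closed)
    then show ?thesis
      using that by (auto simp: goal_def intro!: provable_joinsR[of "goal s"] provable_rdivsR)
  qed
  \<comment> \<open>\<open>w\<close> is the prefix already chosen by the refuter; the induction runs
    from length \<open>N\<close> down to the empty prefix.\<close>
  have "map ?X w @ [Star ?\<alpha>, ?X e] \<tturnstile> ?G" if "set w \<subseteq> set A" "length w \<le> N" for w
    using that
  proof (induction "N - length w" arbitrary: w)
    case 0
    then show ?case using long[of w] win by fastforce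
  next
    case (Suc n)
    have "map ?X w @ [?X e] \<tturnstile> ?G"
      using ended[OF Suc.prems(1)] win[of _ "w @ [e]" "[]"] Suc.prems by fastforce
    moreover have "map ?X w @ x # [Star ?\<alpha>, ?X e] \<tturnstile> ?G" if x: "x \<in> set (map ?X A)" for x
    proof -
      obtain a where "a \<in> set A" "x = ?X a" using x by auto
      then show ?thesis
        using Suc.hyps(1)[of "w @ [a]"] Suc.hyps(2) Suc.prems by simp
    qed
    ultimately show ?case
      by (intro provable_star_split provable_joinsL) simp_all
  qed
  from this[of "[]"] show ?thesis
    by (simp add: game_sequent_def)
qed

text \<open>The game on arbitrary mixed words, because residuals quantify over all words of the
  model and not only over letters followed by symbols.\<close>

inductive wins_word :: "('l \<Rightarrow> 's \<Rightarrow> 's list option) \<Rightarrow> ('l + 's) list \<Rightarrow> bool"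
  for \<delta> :: "'l \<Rightarrow> 's \<Rightarrow> 's list option" where
  fault: "\<delta> a t = None \<Longrightarrow> wins_word \<delta> (Inl a # u @ [Inr t])"
| move: "\<delta> a t = Some v \<Longrightarrow> wins_word \<delta> (u @ map Inr v) \<Longrightarrow> wins_word \<delta> (Inl a # u @ [Inr t])"

lemma letters_then_symbols:
  assumes "Inl a # u @ [Inr t] = map Inl w @ map Inr s"
  obtains w' s' where "w = a # w'" "s = s' @ [t]" "u = map Inl w' @ map Inr s'"
proof -
  obtain w' where w: "w = a # w'"
    using assms by (cases w; cases s) auto
  obtain s' t' where s: "s = s' @ [t']"
  proof (cases s rule: rev_cases)
    case Nil
    then have "Inr t \<in> set (map Inl w)"
      using arg_cong[OF assms, of set] by auto
    then show ?thesis by auto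
  qed
  have "u @ [Inr t] = (map Inl w' @ map Inr s') @ [Inr t']"
    using assms by (simp add: w s)
  then show ?thesis using that w s by simp
qed

lemma wins_word_imp_wins:
  assumes "wins_word \<delta> (map Inl w @ map Inr s)"
  shows "wins \<delta> w s"
  using assms
proof (induction "map Inl w @ map Inr s :: ('a + 'b) list" arbitrary: w s rule: wins_word.induct)
  case (fault a t u)
  then show ?case by (metis letters_then_symbols wins.fault)
next
  case (move a t v u)
  obtain w' s' where *: "w = a # w'" "s = s' @ [t]" "u = map Inl w' @ map Inr s'"
    using move.hyps(4) by (rule letters_then_symbols)
  then have "wins \<delta> w' (s' @ v)" using move.hyps(3) by simp
  then show ?case using * move.hyps(1) by (simp add: wins.move)
qed

text \<open>The countermodel. Subtracting 1 undoes the shift in \<open>stack_var\<close>.\<close>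

definition game_interpretation ::
  "('l \<Rightarrow> 's::countable \<Rightarrow> 's list option) \<Rightarrow> nat \<Rightarrow> ('l + 's) list set" where
  "game_interpretation \<delta> p =
    (if p = 0 then Collect (wins_word \<delta>) else {[Inr (from_nat (p - 1))]})"

lemma sem_stack_var: "sem (game_interpretation \<delta>) (stack_var t) = {[Inr t]}"
  by (simp add: game_interpretation_def stack_var_def)

lemma sems_stack_vars: "sems (game_interpretation \<delta>) (map stack_var s) = {map Inr s}"
  by (induction s) (simp_all add: sem_stack_var conc_def)

text \<open>The rules of \<open>wins_word\<close> are made for this: if the move on \<open>t\<close>
  faults, or \<open>u\<close> followed by the replacement of \<open>t\<close> is won, then the
  letter, \<open>u\<close> and \<open>t\<close> form a won word.\<close>

lemma letter_in_sem: "[Inl a] \<in> sem (game_interpretation \<delta>) (letter_form \<delta> T a)"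
proof -
  let ?I = "game_interpretation \<delta>"
  have "Inl a # u @ [Inr t] \<in> sem ?I answer" if "u \<in> sem ?I (rdivs answer (pushed (\<delta> a t)))" for t u
  proof (cases "\<delta> a t")
    case None
    then show ?thesis by (simp add: game_interpretation_def wins_word.fault)
  next
    case (Some v)
    with that have "u @ map Inr v \<in> sem ?I answer"
      unfolding sem_rdivs by (auto simp: sems_stack_vars conc_def)
    then show ?thesis
      using Some by (simp add: game_interpretation_def wins_word.move)
  qed
  then show ?thesis
    unfolding letter_form_def by (auto simp: sem_joins conc_def sem_stack_var simp del: sem.simps(1))
qed

text \<open>The refuter's word, read in the model, lies in the denotation of the antecedent.
  Soundness puts it into the denotation of one goal, and appending the stack of that goal gives a
  won word.\<close>

lemma derivable_game_sequent_wins: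
  fixes \<delta> :: "'l \<Rightarrow> 's::countable \<Rightarrow> 's list option"
  assumes "derivable ACT\<^sub>\<omega> (game_sequent \<delta> T A e S)" "set w \<subseteq> set A"
  shows "\<exists>s\<in>set S. wins \<delta> (w @ [e]) s"
proof -
  let ?I = "game_interpretation \<delta>" and ?\<alpha> = "joins (map (letter_form \<delta> T) A) Zero"
  have "map Inl w = concat (map (\<lambda>a. [Inl a]) w)"
    by simp
  moreover have "set (map (\<lambda>a. [Inl a]) w) \<subseteq> sem ?I ?\<alpha>"
    using assms(2) by (auto simp: sem_joins intro: letter_in_sem)
  ultimately have "map Inl w \<in> sem ?I (Star ?\<alpha>)"
    unfolding sem.simps by blast
  then have "map Inl w @ [Inl e] \<in> sems ?I [Star ?\<alpha>, letter_form \<delta> T e]"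
    unfolding sems.simps conc_Nil by (intro concI letter_in_sem)
  then have "map Inl w @ [Inl e] \<in> sem ?I (joins (map goal S) Zero)"
    using ACT\<^sub>\<omega>_sound[OF assms(1), of ?I] by (auto simp: valid_def game_sequent_def)
  then obtain s where s: "s \<in> set S" "map Inl w @ [Inl e] \<in> sem ?I (goal s)"
    by (auto simp: sem_joins)
  then have "wins_word \<delta> (map Inl (w @ [e]) @ map Inr s)"
    by (auto simp: goal_def sem_rdivs sems_stack_vars conc_def game_interpretation_def)
  then show ?thesis
    using s(1) wins_word_imp_wins by blast
qed

subsection \<open>Compiling recursive functions to while programs\<close>

datatype cmd = Skip | Inc nat | Dec nat | Seq cmd cmd | While nat cmd

type_synonym store = "nat \<Rightarrow> nat"

inductive exec :: "cmd \<Rightarrow> store \<Rightarrow> store \<Rightarrow> bool" where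
  "exec Skip \<sigma> \<sigma>"
| "exec (Inc r) \<sigma> (\<sigma>(r := Suc (\<sigma> r)))"
| "exec (Dec r) \<sigma> (\<sigma>(r := \<sigma> r - 1))"
| "exec c \<sigma> \<rho> \<Longrightarrow> exec d \<rho> \<tau> \<Longrightarrow> exec (Seq c d) \<sigma> \<tau>"
| "\<sigma> r = 0 \<Longrightarrow> exec (While r c) \<sigma> \<sigma>"
| "\<sigma> r \<noteq> 0 \<Longrightarrow> exec c \<sigma> \<rho> \<Longrightarrow> exec (While r c) \<rho> \<tau> \<Longrightarrow> exec (While r c) \<sigma> \<tau>"

inductive_simps exec_simps [simp]:
  "exec Skip \<sigma> \<tau>" "exec (Inc r) \<sigma> \<tau>" "exec (Dec r) \<sigma> \<tau>" "exec (Seq c d) \<sigma> \<tau>"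

inductive_simps exec_While: "exec (While r c) \<sigma> \<tau>"

definition clear :: "nat \<Rightarrow> cmd" where
  "clear r = While r (Dec r)"

definition move :: "nat \<Rightarrow> nat \<Rightarrow> cmd" where
  "move r s = While r (Seq (Dec r) (Inc s))"

text \<open>The scratch register \<open>t\<close> collects a second copy, from which
  \<open>r\<close> is restored.\<close>

definition copy :: "nat \<Rightarrow> nat \<Rightarrow> nat \<Rightarrow> cmd" where
  "copy r s t = Seq (While r (Seq (Dec r) (Seq (Inc s) (Inc t)))) (move t r)"

text \<open>Stands for calls whose argument list has a length on which the recursive function has no
  value.\<close>

definition diverge :: cmd where
  "diverge = Seq (Inc 0) (While 0 Skip)"

lemma exec_clear [simp]: "exec (clear r) \<sigma> \<tau> \<longleftrightarrow> \<tau> = \<sigma>(r := 0)"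
  unfolding clear_def
proof (induction "\<sigma> r" arbitrary: \<sigma>)
  case 0
  then show ?case by (subst exec_While) (auto simp: fun_upd_idem)
next
  case (Suc n)
  have "\<sigma> r - 1 = n" "\<sigma> r \<noteq> 0" using Suc.hyps(2) by auto
  then show ?case
    using Suc.hyps(1)[of "\<sigma>(r := n)"] by (subst exec_While) simp
qed

lemma exec_move [simp]:
  assumes "r \<noteq> s"
  shows "exec (move r s) \<sigma> \<tau> \<longleftrightarrow> \<tau> = \<sigma>(r := 0, s := \<sigma> s + \<sigma> r)"
  unfolding move_def
proof (induction "\<sigma> r" arbitrary: \<sigma>)
  case 0
  then have "\<sigma>(r := 0, s := \<sigma> s + \<sigma> r) = \<sigma>" by auto
  with 0 show ?case by (subst exec_While) simp
next
  case (Suc n)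
  have "\<sigma> r - 1 = n" "\<sigma> r \<noteq> 0" using Suc.hyps(2) by auto
  moreover have "\<sigma>(r := n, s := Suc (\<sigma> s), r := 0, s := Suc (\<sigma> s) + n) =
      \<sigma>(r := 0, s := \<sigma> s + \<sigma> r)"
    using assms Suc.hyps(2) by auto
  ultimately show ?case
    using assms Suc.hyps(1)[of "\<sigma>(r := n, s := Suc (\<sigma> s))"] by (subst exec_While) simp
qed

lemma exec_copy [simp]:
  assumes "r \<noteq> s" "r \<noteq> t" "s \<noteq> t"
  shows "exec (copy r s t) \<sigma> \<tau> \<longleftrightarrow> \<tau> = \<sigma>(r := \<sigma> r + \<sigma> t, s := \<sigma> s + \<sigma> r, t := 0)"
proof -
  have "exec (While r (Seq (Dec r) (Seq (Inc s) (Inc t)))) \<sigma> \<rho> \<longleftrightarrow>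
    \<rho> = \<sigma>(r := 0, s := \<sigma> s + \<sigma> r, t := \<sigma> t + \<sigma> r)" for \<rho>
  proof (induction "\<sigma> r" arbitrary: \<sigma>)
    case 0
    then have "\<sigma>(r := 0, s := \<sigma> s + \<sigma> r, t := \<sigma> t + \<sigma> r) = \<sigma>" by auto
    with 0 show ?case by (subst exec_While) simp
  next
    case (Suc n)
    let ?\<sigma>' = "\<sigma>(r := n, s := Suc (\<sigma> s), t := Suc (\<sigma> t))"
    have "\<sigma> r - 1 = n" "\<sigma> r \<noteq> 0" using Suc.hyps(2) by auto
    moreover have "?\<sigma>'(r := 0, s := Suc (\<sigma> s) + n, t := Suc (\<sigma> t) + n) =
        \<sigma>(r := 0, s := \<sigma> s + \<sigma> r, t := \<sigma> t + \<sigma> r)"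
      using assms Suc.hyps(2) by auto
    ultimately show ?case
      using assms Suc.hyps(1)[of ?\<sigma>'] by (subst exec_While) simp
  qed
  moreover have "\<sigma>(r := 0, s := \<sigma> s + \<sigma> r, t := 0, r := \<sigma> t + \<sigma> r) =
      \<sigma>(r := \<sigma> r + \<sigma> t, s := \<sigma> s + \<sigma> r, t := 0)"
    using assms by (auto simp: fun_eq_iff)
  ultimately show ?thesis
    using assms by (simp add: copy_def)
qed

text \<open>A terminating run of \<open>While 0 Skip\<close> must start with register 0 empty, since
  \<open>Skip\<close> never changes it.\<close>

lemma not_exec_diverge [simp]: "\<not> exec diverge \<sigma> \<tau>"
proof -
  have "c = While 0 Skip \<Longrightarrow> \<sigma> 0 = 0" if "exec c \<sigma> \<tau>" for c \<sigma>
    using that by induction auto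
  then show ?thesis by (fastforce simp: diverge_def)
qed

primrec clears :: "nat \<Rightarrow> nat \<Rightarrow> cmd" where
  "clears k 0 = Skip"
| "clears k (Suc m) = Seq (clear k) (clears (Suc k) m)"

lemma exec_clears [simp]:
  "exec (clears k m) \<sigma> \<tau> \<longleftrightarrow> \<tau> = (\<lambda>r. if k \<le> r \<and> r < k + m then 0 else \<sigma> r)"
proof (induction m arbitrary: k \<sigma>)
  case (Suc m)
  have "(\<lambda>r. if Suc k \<le> r \<and> r < Suc k + m then 0 else (\<sigma>(k := 0)) r) =
      (\<lambda>r. if k \<le> r \<and> r < k + Suc m then 0 else \<sigma> r)"
    by (auto simp: fun_eq_iff)
  then show ?case by (simp add: Suc)
qed (auto simp: fun_eq_iff)

text \<open>
  \<^term>\<open>compile f as r k\<close> computes \<open>f\<close> on the contents of the registers \<open>as\<close> into the empty register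
  \<open>r\<close>, using the registers from \<open>k\<close> on as scratch space, which is empty before and after.
\<close>

fun compile :: "recf \<Rightarrow> nat list \<Rightarrow> nat \<Rightarrow> nat \<Rightarrow> cmd"
  and compiles :: "recf list \<Rightarrow> nat list \<Rightarrow> nat \<Rightarrow> nat \<Rightarrow> cmd" where
  "compile RZero as r k = Skip"
| "compile RSucc as r k = (case as of [a] \<Rightarrow> Seq (copy a r k) (Inc r) | _ \<Rightarrow> diverge)"
| "compile (RProj i) as r k = (if i < length as then copy (as ! i) r k else diverge)"
| "compile (RComp f gs) as r k =
    Seq (compiles gs as k (k + length gs))
    (Seq (compile f [k..<k + length gs] r (k + length gs))
    (clears k (length gs)))"
| "compile (RPrim f g) as r k = (case as of [] \<Rightarrow> diverge | a # as \<Rightarrow>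
    Seq (copy a (k + 1) k)
    (Seq (compile f as (k + 2) (k + 4))
    (Seq (While (k + 1)
      (Seq (compile g (k # (k + 2) # as) (k + 3) (k + 4))
      (Seq (clear (k + 2)) (Seq (move (k + 3) (k + 2)) (Seq (Inc k) (Dec (k + 1)))))))
    (Seq (clear k) (move (k + 2) r)))))"
| "compile (RMu f) as r k =
    Seq (compile f (k # as) (k + 1) (k + 2))
    (Seq (While (k + 1) (Seq (clear (k + 1)) (Seq (Inc k) (compile f (k # as) (k + 1) (k + 2)))))
    (move k r))"
| "compiles [] as j k = Skip"
| "compiles (g # gs) as j k = Seq (compile g as j k) (compiles gs as (Suc j) k)"

definition free_above :: "nat \<Rightarrow> store \<Rightarrow> bool" where
  "free_above k \<sigma> \<longleftrightarrow> (\<forall>r\<ge>k. \<sigma> r = 0)"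

text \<open>An equivalence, so it records divergence too: no final store exists where
  \<open>f\<close> is undefined. Apart from \<open>r\<close> the store comes back unchanged, scratch
  space included.\<close>

definition computes :: "recf \<Rightarrow> (nat list \<Rightarrow> nat \<Rightarrow> nat \<Rightarrow> cmd) \<Rightarrow> bool" where
  "computes f p \<longleftrightarrow> (\<forall>as r k \<sigma> \<tau>. set as \<subseteq> {..<k} \<longrightarrow> r < k \<longrightarrow> r \<notin> set as \<longrightarrow> \<sigma> r = 0 \<longrightarrow>
    free_above k \<sigma> \<longrightarrow>
    (exec (p as r k) \<sigma> \<tau> \<longleftrightarrow> (\<exists>v. recf_eval f (map \<sigma> as) v \<and> \<tau> = \<sigma>(r := v))))"

lemma computesD:
  assumes "computes f p" "set as \<subseteq> {..<k}" "r < k" "r \<notin> set as" "\<sigma> r = 0" "free_above k \<sigma>"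
  shows "exec (p as r k) \<sigma> \<tau> \<longleftrightarrow> (\<exists>v. recf_eval f (map \<sigma> as) v \<and> \<tau> = \<sigma>(r := v))"
  using assms unfolding computes_def by blast

lemma map_upd_notin [simp]: "a \<notin> set as \<Longrightarrow> map (\<sigma>(a := v)) as = map \<sigma> as"
  by auto

lemma computes_RProj: "computes (RProj i) (compile (RProj i))"
  unfolding computes_def
proof (intro allI impI)
  fix as :: "nat list" and r k :: nat and \<sigma> \<tau> :: store
  assume *: "set as \<subseteq> {..<k}" "r < k" "r \<notin> set as" "\<sigma> r = 0" "free_above k \<sigma>"
  show "exec (compile (RProj i) as r k) \<sigma> \<tau> \<longleftrightarrow>
    (\<exists>v. recf_eval (RProj i) (map \<sigma> as) v \<and> \<tau> = \<sigma>(r := v))"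
  proof (cases "i < length as")
    case True
    then have "as ! i \<in> set as" by simp
    then have "as ! i \<noteq> r" "as ! i \<noteq> k" "r \<noteq> k" using * by auto
    moreover have "\<sigma> k = 0" using * by (simp add: free_above_def)
    moreover have "recf_eval (RProj i) (map \<sigma> as) v \<longleftrightarrow> v = \<sigma> (as ! i)" for v
      using True recf_eval.proj[of i "map \<sigma> as"] by (auto elim: recf_eval_elims)
    ultimately show ?thesis using True * by (simp add: fun_upd_idem fun_upd_twist)
  next
    case False
    then show ?thesis by (auto elim: recf_eval_elims)
  qed
qed

lemma computes_RSucc: "computes RSucc (compile RSucc)"
  unfolding computes_def
proof (intro allI impI)
  fix as :: "nat list" and r k :: nat and \<sigma> \<tau> :: store
  assume *: "set as \<subseteq> {..<k}" "r < k" "r \<notin> set as" "\<sigma> r = 0" "free_above k \<sigma>"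
  show "exec (compile RSucc as r k) \<sigma> \<tau> \<longleftrightarrow>
    (\<exists>v. recf_eval RSucc (map \<sigma> as) v \<and> \<tau> = \<sigma>(r := v))"
  proof (cases "\<exists>a. as = [a]")
    case True
    then obtain a where a: "as = [a]" by blast
    then have "a \<noteq> r" "a \<noteq> k" "r \<noteq> k" using * by auto
    moreover have "\<sigma> k = 0" using * by (simp add: free_above_def)
    moreover have "recf_eval RSucc [\<sigma> a] v \<longleftrightarrow> v = Suc (\<sigma> a)" for v
      using recf_eval.succ by (auto elim: recf_eval_elims)
    ultimately show ?thesis using a * by (simp add: fun_upd_idem fun_upd_twist)
  next
    case False
    then have "compile RSucc as r k = diverge"
      by (auto split: list.split)
    moreover have "\<not> recf_eval RSucc (map \<sigma> as) v" for v
      using False by (auto elim!: recf_eval_elims)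
    ultimately show ?thesis by simp
  qed
qed

lemma computes_RZero: "computes RZero (compile RZero)"
  by (auto simp: computes_def fun_upd_idem intro: recf_eval.zero elim: recf_eval_elims)

text \<open>The scratch space from \<open>k\<close> on lies above all result registers, so later
  calls do not disturb earlier results.\<close>

lemma exec_compiles:
  assumes "\<And>g. g \<in> set gs \<Longrightarrow> computes g (compile g)"
    and "set as \<subseteq> {..<j}" "j + length gs \<le> k" "free_above j \<sigma>"
  shows "exec (compiles gs as j k) \<sigma> \<tau> \<longleftrightarrow>
    (\<exists>vs. list_all2 (\<lambda>g v. recf_eval g (map \<sigma> as) v) gs vs \<and>
      \<tau> = (\<lambda>r. if j \<le> r \<and> r < j + length gs then vs ! (r - j) else \<sigma> r))"
  using assms
proof (induction gs arbitrary: j \<sigma>)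
  case Nil
  then show ?case by auto
next
  case (Cons g gs)
  have g: "exec (compile g as j k) \<sigma> \<rho> \<longleftrightarrow> (\<exists>v. recf_eval g (map \<sigma> as) v \<and> \<rho> = \<sigma>(j := v))" for \<rho>
    using Cons.prems by (intro computesD) (auto simp: free_above_def)
  have j: "j \<notin> set as" using Cons.prems by auto
  have gs: "exec (compiles gs as (Suc j) k) (\<sigma>(j := v)) \<tau> \<longleftrightarrow>
    (\<exists>vs. list_all2 (\<lambda>g v. recf_eval g (map \<sigma> as) v) gs vs \<and>
      \<tau> = (\<lambda>r. if Suc j \<le> r \<and> r < Suc j + length gs then vs ! (r - Suc j) else (\<sigma>(j := v)) r))" for v
    using Cons.prems j
    by (subst Cons.IH) (auto simp: free_above_def lessThan_Suc)
  have upd: "(\<lambda>r. if Suc j \<le> r \<and> r < Suc j + length gs then vs ! (r - Suc j) else (\<sigma>(j := v)) r) =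
      (\<lambda>r. if j \<le> r \<and> r < j + length (g # gs) then (v # vs) ! (r - j) else \<sigma> r)" for v vs
  proof
    fix q
    show "(if Suc j \<le> q \<and> q < Suc j + length gs then vs ! (q - Suc j) else (\<sigma>(j := v)) q) =
        (if j \<le> q \<and> q < j + length (g # gs) then (v # vs) ! (q - j) else \<sigma> q)"
    proof (cases "j < q")
      case True
      then have "q - j = Suc (q - Suc j)" by simp
      then show ?thesis using True by simp
    qed auto
  qed
  let ?U = "\<lambda>vs r. if j \<le> r \<and> r < j + length (g # gs) then vs ! (r - j) else \<sigma> r"
  have "exec (compiles (g # gs) as j k) \<sigma> \<tau> \<longleftrightarrow>
      (\<exists>v. recf_eval g (map \<sigma> as) v \<and> exec (compiles gs as (Suc j) k) (\<sigma>(j := v)) \<tau>)"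
    unfolding compiles.simps exec_simps g by blast
  also have "\<dots> \<longleftrightarrow> (\<exists>v vs. recf_eval g (map \<sigma> as) v \<and>
      list_all2 (\<lambda>g v. recf_eval g (map \<sigma> as) v) gs vs \<and> \<tau> = ?U (v # vs))"
    unfolding gs upd by blast
  also have "\<dots> \<longleftrightarrow> (\<exists>vs. list_all2 (\<lambda>g v. recf_eval g (map \<sigma> as) v) (g # gs) vs \<and> \<tau> = ?U vs)"
    unfolding list_all2_Cons1 by blast
  finally show ?case .
qed

lemma computes_RComp:
  assumes f: "computes f (compile f)" and gs: "\<And>g. g \<in> set gs \<Longrightarrow> computes g (compile g)"
  shows "computes (RComp f gs) (compile (RComp f gs))"
  unfolding computes_def
proof (intro allI impI)
  fix as :: "nat list" and r k :: nat and \<sigma> \<tau> :: store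
  assume *: "set as \<subseteq> {..<k}" "r < k" "r \<notin> set as" "\<sigma> r = 0" "free_above k \<sigma>"
  let ?m = "length gs" and ?xs = "map \<sigma> as"
  let ?E = "list_all2 (\<lambda>g v. recf_eval g ?xs v) gs"
  \<comment> \<open>\<open>S vs\<close> is the store once the arguments have been computed,
    \<open>C\<close> the effect of the final cleanup.\<close>
  define S where "S vs = (\<lambda>r. if k \<le> r \<and> r < k + ?m then vs ! (r - k) else \<sigma> r)" for vs
  define C where "C \<rho> = (\<lambda>r. if k \<le> r \<and> r < k + ?m then 0 else \<rho> r)" for \<rho> :: store
  have 1: "exec (compiles gs as k (k + ?m)) \<sigma> \<rho> \<longleftrightarrow> (\<exists>vs. ?E vs \<and> \<rho> = S vs)" for \<rho>
    unfolding S_def using * gs by (intro exec_compiles) auto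
  have 2: "exec (compile f [k..<k + ?m] r (k + ?m)) (S vs) \<rho> \<longleftrightarrow>
      (\<exists>z. recf_eval f vs z \<and> \<rho> = (S vs)(r := z))" if "?E vs" for vs \<rho>
  proof -
    have "length vs = ?m" using that by (simp add: list_all2_lengthD)
    then have "map (S vs) [k..<k + ?m] = vs" by (auto simp: S_def intro: nth_equalityI)
    then show ?thesis using f * by (subst computesD[OF f]) (auto simp: S_def free_above_def)
  qed
  have 3: "C ((S vs)(r := z)) = \<sigma>(r := z)" for vs z
    using * by (auto simp: fun_eq_iff free_above_def S_def C_def)
  have "exec (compile (RComp f gs) as r k) \<sigma> \<tau> \<longleftrightarrow>
    (\<exists>vs. ?E vs \<and> (\<exists>\<rho>. exec (compile f [k..<k + ?m] r (k + ?m)) (S vs) \<rho> \<and> \<tau> = C \<rho>))"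
    unfolding compile.simps exec_simps exec_clears 1 C_def by blast
  also have "\<dots> \<longleftrightarrow> (\<exists>vs. ?E vs \<and> (\<exists>\<rho>. (\<exists>z. recf_eval f vs z \<and> \<rho> = (S vs)(r := z)) \<and> \<tau> = C \<rho>))"
    by (rule ex_cong) (use 2 in simp)
  also have "\<dots> \<longleftrightarrow> (\<exists>vs z. ?E vs \<and> recf_eval f vs z \<and> \<tau> = C ((S vs)(r := z)))"
    by blast
  also have "\<dots> \<longleftrightarrow> (\<exists>vs z. ?E vs \<and> recf_eval f vs z \<and> \<tau> = \<sigma>(r := z))"
    unfolding 3 ..
  also have "\<dots> \<longleftrightarrow> (\<exists>v. recf_eval (RComp f gs) ?xs v \<and> \<tau> = \<sigma>(r := v))"
  proof -
    have "recf_eval (RComp f gs) ?xs v \<longleftrightarrow> (\<exists>vs. ?E vs \<and> recf_eval f vs v)" for v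
      by (blast intro: recf_eval.comp elim: recf_eval_elims)
    then show ?thesis by blast
  qed
  finally show "exec (compile (RComp f gs) as r k) \<sigma> \<tau> \<longleftrightarrow>
    (\<exists>v. recf_eval (RComp f gs) ?xs v \<and> \<tau> = \<sigma>(r := v))" .
qed

text \<open>Evaluation at \<open>n\<close> passes through all smaller counters. Hence no round of
  the compiled loop can diverge when the final value exists.\<close>

lemma RPrim_defined_below:
  assumes "recf_eval (RPrim f g) (n # xs) v" "m \<le> n"
  shows "\<exists>w. recf_eval (RPrim f g) (m # xs) w"
  using assms(2,1)
proof (induction arbitrary: v rule: inc_induct)
  case (step m)
  then show ?case by (blast elim: recf_eval_elims)
qed blast

lemma computes_RPrim:
  assumes f: "computes f (compile f)" and g: "computes g (compile g)"
  shows "computes (RPrim f g) (compile (RPrim f g))"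
  unfolding computes_def
proof (intro allI impI)
  fix as :: "nat list" and r k :: nat and \<sigma> \<tau> :: store
  assume *: "set as \<subseteq> {..<k}" "r < k" "r \<notin> set as" "\<sigma> r = 0" "free_above k \<sigma>"
  show "exec (compile (RPrim f g) as r k) \<sigma> \<tau> \<longleftrightarrow>
    (\<exists>v. recf_eval (RPrim f g) (map \<sigma> as) v \<and> \<tau> = \<sigma>(r := v))"
  proof (cases as)
    case Nil
    then show ?thesis by (auto elim: recf_eval.cases)
  next
    case (Cons a as')
    let ?xs = "map \<sigma> as'"
    \<comment> \<open>Register layout: \<open>k\<close> holds the counter reached,
      \<open>k + 1\<close> the rounds left, \<open>k + 2\<close> the value at the counter. The next
      value is computed in \<open>k + 3\<close> and then moved.\<close>
    define S where "S i y n = \<sigma>(k := i, k + 1 := n, k + 2 := y)" for i y n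
    have as: "set as' \<subseteq> {..<k}" "a < k" "r \<notin> set as'" "a \<noteq> r" using * Cons by auto
    then have notin: "k \<notin> set as'" "k + 1 \<notin> set as'" "k + 2 \<notin> set as'" "k + 3 \<notin> set as'"
      by auto
    have zero: "\<sigma> k = 0" "\<sigma> (k + 1) = 0" "\<sigma> (k + 2) = 0" "\<sigma> (k + 3) = 0"
      using * by (simp_all add: free_above_def)
    define shift where "shift =
      Seq (clear (k + 2)) (Seq (move (k + 3) (k + 2)) (Seq (Inc k) (Dec (k + 1))))"
    define body where "body = Seq (compile g (k # (k + 2) # as') (k + 3) (k + 4)) shift"
    have 1: "exec (copy a (k + 1) k) \<sigma> \<rho> \<longleftrightarrow> \<rho> = S 0 0 (\<sigma> a)" for \<rho>
      using as zero by (subst exec_copy) (auto simp: S_def fun_eq_iff)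
    have 2: "exec (compile f as' (k + 2) (k + 4)) (S 0 0 n) \<rho> \<longleftrightarrow>
        (\<exists>y. recf_eval f ?xs y \<and> \<rho> = S 0 y n)" for n \<rho>
      using as * notin by (subst computesD[OF f]) (auto simp: S_def free_above_def)
    have 3: "exec body (S i y (Suc n)) \<rho> \<longleftrightarrow>
        (\<exists>z. recf_eval g (i # y # ?xs) z \<and> \<rho> = S (Suc i) z n)" for i y n \<rho>
    proof -
      have A: "exec (compile g (k # (k + 2) # as') (k + 3) (k + 4)) (S i y (Suc n)) \<rho> \<longleftrightarrow>
        (\<exists>z. recf_eval g (i # y # ?xs) z \<and> \<rho> = (S i y (Suc n))(k + 3 := z))" for \<rho>
        using as * notin zero by (subst computesD[OF g]) (auto simp: S_def free_above_def)
      have B: "exec shift ((S i y (Suc n))(k + 3 := z)) \<rho> \<longleftrightarrow> \<rho> = S (Suc i) z n" for z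
      proof -
        have "S (Suc i) z n = (S i y (Suc n))
          (k + 3 := z, k + 2 := 0, k + 3 := 0, k + 2 := z, k := Suc i, k + 1 := n)"
          using zero by (auto simp: fun_eq_iff S_def)
        then show ?thesis by (simp add: S_def shift_def)
      qed
      have "exec body (S i y (Suc n)) \<rho> \<longleftrightarrow>
        (\<exists>z. recf_eval g (i # y # ?xs) z \<and> exec shift ((S i y (Suc n))(k + 3 := z)) \<rho>)"
        unfolding body_def exec_simps(4) A by blast
      then show ?thesis unfolding B .
    qed
    \<comment> \<open>The loop invariant, for any starting counter \<open>i\<close>, so that the
      induction on the remaining rounds can pass to \<open>Suc i\<close>.\<close>
    have 4: "exec (While (k + 1) body) (S i y n) \<rho> \<longleftrightarrow>
        (\<exists>v. recf_eval (RPrim f g) ((i + n) # ?xs) v \<and> \<rho> = S (i + n) v 0)"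
      if "recf_eval (RPrim f g) (i # ?xs) y" for i y n \<rho>
      using that
    proof (induction n arbitrary: i y)
      case 0
      then show ?case
        by (subst exec_While) (auto simp: S_def dest: recf_eval_deterministic)
    next
      case (Suc n)
      have "exec (While (k + 1) body) (S i y (Suc n)) \<rho> \<longleftrightarrow>
        (\<exists>z. recf_eval g (i # y # ?xs) z \<and> exec (While (k + 1) body) (S (Suc i) z n) \<rho>)"
        by (subst exec_While) (use 3 in \<open>auto simp: S_def\<close>)
      also have "\<dots> \<longleftrightarrow> (\<exists>z. recf_eval g (i # y # ?xs) z \<and>
        (\<exists>v. recf_eval (RPrim f g) ((Suc i + n) # ?xs) v \<and> \<rho> = S (Suc i + n) v 0))"
        by (intro ex_cong1 conj_cong refl Suc.IH recf_eval.prim_Suc[OF Suc.prems])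
      also have "\<dots> \<longleftrightarrow> (\<exists>v. recf_eval (RPrim f g) ((Suc i + n) # ?xs) v \<and> \<rho> = S (Suc i + n) v 0)"
      proof -
        \<comment> \<open>A value at a later counter forces one at \<open>Suc i\<close>, and by
          determinism \<open>g\<close> was applied to this very \<open>y\<close>.\<close>
        have "\<exists>z. recf_eval g (i # y # ?xs) z" if v: "recf_eval (RPrim f g) ((Suc i + n) # ?xs) v" for v
        proof -
          obtain w where "recf_eval (RPrim f g) (Suc i # ?xs) w"
            using RPrim_defined_below[OF v, of "Suc i"] by auto
          then show ?thesis
            using Suc.prems recf_eval_deterministic by (blast elim: recf_eval_elims)
        qed
        then show ?thesis by blast
      qed
      finally show ?case by simp
    qed
    have 5: "(S i v 0)(k := 0, k + 2 := 0, r := S i v 0 r + S i v 0 (k + 2)) = \<sigma>(r := v)" for i v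
      using zero * by (auto simp: fun_eq_iff S_def)
    have "exec (compile (RPrim f g) as r k) \<sigma> \<tau> \<longleftrightarrow>
      (\<exists>y. recf_eval f ?xs y \<and> (\<exists>\<rho>. exec (While (k + 1) body) (S 0 y (\<sigma> a)) \<rho> \<and>
        \<tau> = \<rho>(k := 0, k + 2 := 0, r := \<rho> r + \<rho> (k + 2))))"
      unfolding Cons compile.simps list.case exec_simps 1 shift_def[symmetric] body_def[symmetric]
      using * 2 by auto
    also have "\<dots> \<longleftrightarrow> (\<exists>y. recf_eval f ?xs y \<and>
        (\<exists>v. recf_eval (RPrim f g) (\<sigma> a # ?xs) v \<and> \<tau> = \<sigma>(r := v)))"
    proof -
      have "(\<exists>\<rho>. exec (While (k + 1) body) (S 0 y (\<sigma> a)) \<rho> \<and>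
        \<tau> = \<rho>(k := 0, k + 2 := 0, r := \<rho> r + \<rho> (k + 2))) \<longleftrightarrow>
        (\<exists>v. recf_eval (RPrim f g) (\<sigma> a # ?xs) v \<and> \<tau> = \<sigma>(r := v))" if "recf_eval f ?xs y" for y
        using 4[OF recf_eval.prim_0[OF that], of "\<sigma> a"] 5 by auto
      then show ?thesis by blast
    qed
    also have "\<dots> \<longleftrightarrow> (\<exists>v. recf_eval (RPrim f g) (map \<sigma> as) v \<and> \<tau> = \<sigma>(r := v))"
      using RPrim_defined_below[of f g "\<sigma> a" ?xs _ 0] by (auto simp: Cons elim: recf_eval_elims)
    finally show ?thesis .
  qed
qed

lemma computes_RMu:
  assumes f: "computes f (compile f)"
  shows "computes (RMu f) (compile (RMu f))"
  unfolding computes_def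
proof (intro allI impI)
  fix as :: "nat list" and r k :: nat and \<sigma> \<tau> :: store
  assume *: "set as \<subseteq> {..<k}" "r < k" "r \<notin> set as" "\<sigma> r = 0" "free_above k \<sigma>"
  let ?xs = "map \<sigma> as"
  \<comment> \<open>\<open>k\<close> holds the current candidate and \<open>k + 1\<close> the value
    of \<open>f\<close> at it.\<close>
  define S where "S i y = \<sigma>(k := i, k + 1 := y)" for i y
  have notin: "k \<notin> set as" "k + 1 \<notin> set as" using * by auto
  have zero: "\<sigma> k = 0" "\<sigma> (k + 1) = 0" using * by (simp_all add: free_above_def)
  define body where "body = Seq (clear (k + 1)) (Seq (Inc k) (compile f (k # as) (k + 1) (k + 2)))"
  have 1: "exec (compile f (k # as) (k + 1) (k + 2)) (S i 0) \<rho> \<longleftrightarrow>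
      (\<exists>y. recf_eval f (i # ?xs) y \<and> \<rho> = S i y)" for i \<rho>
    using * notin by (subst computesD[OF f]) (auto simp: S_def free_above_def)
  have 2: "exec body (S i y) \<rho> \<longleftrightarrow> (\<exists>z. recf_eval f (Suc i # ?xs) z \<and> \<rho> = S (Suc i) z)" for i y \<rho>
  proof -
    have "(S i y)(k + 1 := 0, k := Suc i) = S (Suc i) 0" by (auto simp: S_def)
    then show ?thesis using 1[of "Suc i"] by (simp add: body_def) (simp add: S_def)
  qed
  let ?R = "\<lambda>i n. i \<le> n \<and> recf_eval f (n # ?xs) 0 \<and> (\<forall>m. i \<le> m \<longrightarrow> m < n \<longrightarrow> (\<exists>z. recf_eval f (m # ?xs) (Suc z)))"
  \<comment> \<open>Partial correctness, by induction on the execution; cases 5 and 6 are the two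
    rules for \<open>While\<close>.\<close>
  have 3: "\<exists>n. ?R i n \<and> \<rho>' = S n 0"
    if "exec c \<rho> \<rho>'" "c = While (k + 1) body" "\<rho> = S i y" "recf_eval f (i # ?xs) y" for c \<rho> \<rho>' i y
    using that
  proof (induction arbitrary: i y)
    case (5 \<rho> q c)
    then show ?case by (auto simp: S_def)
  next
    case (6 \<rho>\<^sub>1 q c \<rho>\<^sub>2 \<rho>\<^sub>3)
    then have "exec body (S i y) \<rho>\<^sub>2" by simp
    then obtain z where z: "recf_eval f (Suc i # ?xs) z" "\<rho>\<^sub>2 = S (Suc i) z"
      unfolding 2 by blast
    obtain n where n: "?R (Suc i) n" "\<rho>\<^sub>3 = S n 0"
      using "6.IH"(2)[OF "6.prems"(1) z(2,1)] by blast
    have "y \<noteq> 0" using 6 by (auto simp: S_def)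
    then obtain y' where y': "y = Suc y'" by (cases y) auto
    have "\<exists>z. recf_eval f (m # ?xs) (Suc z)" if "i \<le> m" "m < n" for m
      using that n(1) "6.prems"(3) y' by (cases "m = i") auto
    then have "?R i n" using n(1) by auto
    then show ?case using n(2) by blast
  qed auto
  \<comment> \<open>Termination, by induction on the distance to the first zero.\<close>
  have 4: "exec (While (k + 1) body) (S i y) (S n 0)" if "?R i n" "recf_eval f (i # ?xs) y" for i y n
    using that
  proof (induction "n - i" arbitrary: i y)
    case 0
    then have "y = 0" "i = n" by (auto dest: recf_eval_deterministic)
    then show ?case by (subst exec_While) (auto simp: S_def)
  next
    case (Suc m)
    then have "i < n" by simp
    then obtain y' where "recf_eval f (i # ?xs) (Suc y')" using Suc.prems(1) by blast
    then have y: "S i y (k + 1) \<noteq> 0"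
      using Suc.prems(2) recf_eval_deterministic by (fastforce simp: S_def)
    obtain z where z: "recf_eval f (Suc i # ?xs) z"
    proof (cases "Suc i = n")
      case False
      then have "i \<le> Suc i" "Suc i < n" using \<open>i < n\<close> by auto
      then show ?thesis using that Suc.prems(1) by blast
    qed (use Suc.prems(1) that in blast)
    have "exec (While (k + 1) body) (S (Suc i) z) (S n 0)"
      using Suc.hyps Suc.prems(1) \<open>i < n\<close> z by auto
    moreover have "exec body (S i y) (S (Suc i) z)" using 2 z by blast
    ultimately show ?case
      using y by (subst exec_While) blast
  qed
  have 5: "(\<exists>y. recf_eval f (0 # ?xs) y \<and> exec (While (k + 1) body) (S 0 y) \<rho>) \<longleftrightarrow>
      (\<exists>n. recf_eval (RMu f) ?xs n \<and> \<rho> = S n 0)" for \<rho>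
  proof -
    have R: "recf_eval (RMu f) ?xs n \<longleftrightarrow> ?R 0 n" for n
      by (auto intro: recf_eval.mu elim: recf_eval_elims)
    show ?thesis
    proof
      assume "\<exists>y. recf_eval f (0 # ?xs) y \<and> exec (While (k + 1) body) (S 0 y) \<rho>"
      then obtain y where "recf_eval f (0 # ?xs) y" "exec (While (k + 1) body) (S 0 y) \<rho>"
        by blast
      from 3[OF this(2) refl refl this(1)] show "\<exists>n. recf_eval (RMu f) ?xs n \<and> \<rho> = S n 0"
        unfolding R .
    next
      assume "\<exists>n. recf_eval (RMu f) ?xs n \<and> \<rho> = S n 0"
      then obtain n where n: "?R 0 n" "\<rho> = S n 0" unfolding R by blast
      moreover obtain y where y: "recf_eval f (0 # ?xs) y"
        using n(1) by (cases n) auto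
      ultimately have "exec (While (k + 1) body) (S 0 y) \<rho>" using 4 by simp
      with y show "\<exists>y. recf_eval f (0 # ?xs) y \<and> exec (While (k + 1) body) (S 0 y) \<rho>"
        by blast
    qed
  qed
  have 6: "(S n 0)(k := 0, r := S n 0 r + S n 0 k) = \<sigma>(r := n)" for n
    using zero * by (auto simp: fun_eq_iff S_def)
  have "exec (compile (RMu f) as r k) \<sigma> \<tau> \<longleftrightarrow>
    (\<exists>\<rho>. (\<exists>y. recf_eval f (0 # ?xs) y \<and> exec (While (k + 1) body) (S 0 y) \<rho>) \<and>
      \<tau> = \<rho>(k := 0, r := \<rho> r + \<rho> k))"
  proof -
    have "\<sigma> = S 0 0" using zero by (auto simp: S_def)
    then have A: "exec (compile f (k # as) (k + 1) (k + 2)) \<sigma> \<rho> \<longleftrightarrow>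
      (\<exists>y. recf_eval f (0 # ?xs) y \<and> \<rho> = S 0 y)" for \<rho> using 1[of 0] by simp
    have B: "exec (move k r) \<rho> \<tau> \<longleftrightarrow> \<tau> = \<rho>(k := 0, r := \<rho> r + \<rho> k)" for \<rho>
      using * by simp
    show ?thesis
      unfolding compile.simps exec_simps body_def[symmetric] A B by blast
  qed
  also have "\<dots> \<longleftrightarrow> (\<exists>v. recf_eval (RMu f) ?xs v \<and> \<tau> = \<sigma>(r := v))"
    unfolding 5 using 6 by auto
  finally show "exec (compile (RMu f) as r k) \<sigma> \<tau> \<longleftrightarrow>
    (\<exists>v. recf_eval (RMu f) ?xs v \<and> \<tau> = \<sigma>(r := v))" .
qed

lemma computes_compile: "computes f (compile f)"
  by (induction f)
    (simp_all add: computes_RZero computes_RSucc computes_RProj computes_RComp computes_RPrim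
      computes_RMu del: compile.simps)

subsection \<open>Races between programs\<close>

text \<open>A small step is split into store update (\<open>effect\<close>), control update
  (\<open>continuation\<close>) and test (\<open>branch_ok\<close>), so that each can be checked on
  a stack of its own.\<close>

primrec effect :: "cmd \<Rightarrow> store \<Rightarrow> store" where
  "effect Skip \<sigma> = \<sigma>"
| "effect (Inc r) \<sigma> = \<sigma>(r := Suc (\<sigma> r))"
| "effect (Dec r) \<sigma> = \<sigma>(r := \<sigma> r - 1)"
| "effect (Seq c d) \<sigma> = \<sigma>"
| "effect (While r c) \<sigma> = \<sigma>"

primrec continuation :: "bool \<Rightarrow> cmd \<Rightarrow> cmd list" where
  "continuation \<beta> Skip = []"
| "continuation \<beta> (Inc r) = []"
| "continuation \<beta> (Dec r) = []"
| "continuation \<beta> (Seq c d) = [c, d]"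
| "continuation \<beta> (While r c) = (if \<beta> then [c, While r c] else [])"

primrec branch_ok :: "cmd \<Rightarrow> bool \<Rightarrow> store \<Rightarrow> bool" where
  "branch_ok Skip \<beta> \<sigma> = True"
| "branch_ok (Inc r) \<beta> \<sigma> = True"
| "branch_ok (Dec r) \<beta> \<sigma> = True"
| "branch_ok (Seq c d) \<beta> \<sigma> = True"
| "branch_ok (While r c) \<beta> \<sigma> = (\<beta> \<longleftrightarrow> \<sigma> r \<noteq> 0)"

text \<open>\<open>branch_ok c True \<sigma>\<close> is the branch that a loop really takes. The
  empty control stack is a fixed point, which keeps a halted program halted.\<close>

fun step :: "cmd list \<times> store \<Rightarrow> cmd list \<times> store" where
  "step ([], \<sigma>) = ([], \<sigma>)"
| "step (c # K, \<sigma>) = (continuation (branch_ok c True \<sigma>) c @ K, effect c \<sigma>)"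

definition halts :: "cmd list \<times> store \<Rightarrow> bool" where
  "halts S \<longleftrightarrow> (\<exists>n. fst ((step ^^ n) S) = [])"

lemma continuation_branch_ok:
  "branch_ok c \<beta> \<sigma> \<Longrightarrow> continuation (branch_ok c True \<sigma>) c = continuation \<beta> c"
  by (cases c) auto

lemma halts_step [simp]: "halts (step S) \<longleftrightarrow> halts S"
proof
  assume "halts (step S)"
  then obtain n where "fst ((step ^^ n) (step S)) = []" by (auto simp: halts_def)
  then show "halts S" unfolding halts_def by (intro exI[of _ "Suc n"]) (simp add: funpow_swap1)
next
  assume "halts S"
  then obtain n where n: "fst ((step ^^ n) S) = []" by (auto simp: halts_def)
  then have "step ((step ^^ n) S) = (step ^^ n) S" by (cases "(step ^^ n) S") auto
  with n show "halts (step S)" unfolding halts_def by (intro exI[of _ n]) (simp add: funpow_swap1)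
qed

lemma step_star_trans:
  "(step ^^ m) S = S' \<Longrightarrow> (step ^^ n) S' = S'' \<Longrightarrow> (step ^^ (n + m)) S = S''"
  by (simp add: funpow_add)

text \<open>The rest \<open>K\<close> of the control stack is arbitrary so that the runs of
  subcommands can be concatenated.\<close>

lemma exec_steps: "exec c \<sigma> \<tau> \<Longrightarrow> \<exists>n. (step ^^ n) (c # K, \<sigma>) = (K, \<tau>)"
proof (induction arbitrary: K rule: exec.induct)
  case (4 c \<sigma> \<rho> d \<tau>)
  obtain m where m: "(step ^^ m) (c # d # K, \<sigma>) = (d # K, \<rho>)" using 4 by blast
  obtain n where n: "(step ^^ n) (d # K, \<rho>) = (K, \<tau>)" using 4 by blast
  have "(step ^^ 1) (Seq c d # K, \<sigma>) = (c # d # K, \<sigma>)" by simp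
  from step_star_trans[OF step_star_trans[OF this m] n] show ?case by blast
next
  case (6 \<sigma> r c \<rho> \<tau>)
  obtain m where m: "(step ^^ m) (c # While r c # K, \<sigma>) = (While r c # K, \<rho>)" using 6 by blast
  obtain n where n: "(step ^^ n) (While r c # K, \<rho>) = (K, \<tau>)" using 6 by blast
  have "(step ^^ 1) (While r c # K, \<sigma>) = (c # While r c # K, \<sigma>)" using 6 by simp
  from step_star_trans[OF step_star_trans[OF this m] n] show ?case by blast
qed (auto intro: exI[of _ 1])

text \<open>Big-step meaning of a whole control stack: the invariant for recovering a big-step
  execution from small steps.\<close>

primrec execs :: "cmd list \<Rightarrow> store \<Rightarrow> store \<Rightarrow> bool" where
  "execs [] \<sigma> \<tau> \<longleftrightarrow> \<tau> = \<sigma>"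
| "execs (c # K) \<sigma> \<tau> \<longleftrightarrow> (\<exists>\<rho>. exec c \<sigma> \<rho> \<and> execs K \<rho> \<tau>)"

lemma execs_step: "execs (fst (step (K, \<sigma>))) (snd (step (K, \<sigma>))) \<tau> \<Longrightarrow> execs K \<sigma> \<tau>"
proof (cases K)
  case (Cons c K')
  assume *: "execs (fst (step (K, \<sigma>))) (snd (step (K, \<sigma>))) \<tau>"
  show ?thesis
  proof (cases c)
    case (While r d)
    with * Cons show ?thesis
      by (cases "\<sigma> r = 0") (auto intro: exec.intros(5,6))
  qed (use * Cons in auto)
qed simp

lemma steps_execs: "fst ((step ^^ n) (K, \<sigma>)) = [] \<Longrightarrow> \<exists>\<tau>. execs K \<sigma> \<tau>"
proof (induction n arbitrary: K \<sigma>)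
  case (Suc n)
  then have "\<exists>\<tau>. execs (fst (step (K, \<sigma>))) (snd (step (K, \<sigma>))) \<tau>"
    by (simp add: funpow_swap1)
  then show ?case using execs_step by blast
next
  case 0
  then have "execs K \<sigma> \<sigma>" by simp
  then show ?case by blast
qed

lemma halts_iff_exec: "halts ([c], \<sigma>) \<longleftrightarrow> (\<exists>\<tau>. exec c \<sigma> \<tau>)"
proof
  assume "halts ([c], \<sigma>)"
  then show "\<exists>\<tau>. exec c \<sigma> \<tau>" using steps_execs[of _ "[c]" \<sigma>] by (auto simp: halts_def)
next
  assume "\<exists>\<tau>. exec c \<sigma> \<tau>"
  then obtain \<tau> n where "(step ^^ n) ([c], \<sigma>) = ([], \<tau>)" using exec_steps by blast
  then show "halts ([c], \<sigma>)" unfolding halts_def by (metis fst_conv)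
qed

section \<open>Consistency checks as stack games\<close>

datatype sym = Turn bool | End bool | Ctl bool cmd | Bot bool nat | Cnt bool nat

instance cmd :: countable by countable_datatype
instance sym :: countable by countable_datatype

datatype letter = Op bool cmd bool | Finish

text \<open>The number of counters to put on the bottom marker when a command meets an empty
  register, or \<open>None\<close> if the claimed branch contradicts emptiness. In
  \<open>at_positive\<close> it is the number that replaces one popped counter.\<close>

fun at_zero :: "cmd \<Rightarrow> bool \<Rightarrow> nat \<Rightarrow> nat option" where
  "at_zero (Inc q) \<beta> r = Some (if q = r then 1 else 0)"
| "at_zero (While q c) \<beta> r = (if q = r \<and> \<beta> then None else Some 0)"
| "at_zero c \<beta> r = Some 0"

fun at_positive :: "cmd \<Rightarrow> bool \<Rightarrow> nat \<Rightarrow> nat option" where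
  "at_positive (Inc q) \<beta> r = Some (if q = r then 2 else 1)"
| "at_positive (Dec q) \<beta> r = Some (if q = r then 0 else 1)"
| "at_positive (While q c) \<beta> r = (if q = r \<and> \<not> \<beta> then None else Some 1)"
| "at_positive c \<beta> r = Some 1"

text \<open>Control and register stacks react only to letters of their own program. A command
  executed at \<open>End\<close> runs a halted program and is a fault; \<open>Finish\<close> faults
  exactly when program \<open>True\<close> has a command on top.\<close>

fun check_move :: "letter \<Rightarrow> sym \<Rightarrow> sym list option" where
  "check_move (Op m c \<beta>) (Turn n) = (if n = m then Some [Turn (\<not> m)] else None)"
| "check_move (Op m c \<beta>) (End n) = (if n = m then None else Some [End n])"
| "check_move (Op m c \<beta>) (Ctl n d) =
    (if n \<noteq> m then Some [Ctl n d] else if d \<noteq> c then None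
     else Some (map (Ctl m) (rev (continuation \<beta> c))))"
| "check_move (Op m c \<beta>) (Bot n r) =
    (if n \<noteq> m then Some [Bot n r]
     else map_option (\<lambda>k. Bot m r # replicate k (Cnt m r)) (at_zero c \<beta> r))"
| "check_move (Op m c \<beta>) (Cnt n r) =
    (if n \<noteq> m then Some [Cnt n r]
     else map_option (\<lambda>k. replicate k (Cnt m r)) (at_positive c \<beta> r))"
| "check_move Finish (Ctl m c) = (if m then None else Some [Ctl m c])"
| "check_move Finish t = Some [t]"

type_synonym config = "bool \<times> (bool \<Rightarrow> cmd list \<times> store)"

datatype check = TurnCheck | CtlCheck bool | RegCheck bool nat

text \<open>The top is at the right end, hence \<open>rev\<close>; register contents are written in
  unary. Index \<open>False\<close> is the first program, \<open>True\<close> the second.\<close>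

fun stack :: "check \<Rightarrow> config \<Rightarrow> sym list" where
  "stack TurnCheck (t, C) = [Turn t]"
| "stack (CtlCheck m) (t, C) = End m # map (Ctl m) (rev (fst (C m)))"
| "stack (RegCheck m r) (t, C) = Bot m r # replicate (snd (C m) r) (Cnt m r)"

abbreviation advance :: "config \<Rightarrow> config" where
  "advance \<equiv> \<lambda>(t, C). (\<not> t, C(t := step (C t)))"

fun enabled :: "letter \<Rightarrow> config \<Rightarrow> bool" where
  "enabled (Op m c \<beta>) (t, C) \<longleftrightarrow>
    m = t \<and> (\<exists>K. fst (C m) = c # K) \<and> branch_ok c \<beta> (snd (C m))"
| "enabled Finish _ \<longleftrightarrow> False"

lemma wins_unchanged:
  assumes "check_move a t = Some [t]"
  shows "wins check_move (a # w) (s @ [t]) \<longleftrightarrow> wins check_move w (s @ [t])"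
  using assms by (simp add: wins_Cons_snoc)

lemma stack_snoc:
  "stack (CtlCheck m) (t, C) = (case fst (C m) of [] \<Rightarrow> [] @ [End m]
    | c # K \<Rightarrow> (End m # map (Ctl m) (rev K)) @ [Ctl m c])"
  "stack (RegCheck m r) (t, C) = (case snd (C m) r of 0 \<Rightarrow> [] @ [Bot m r]
    | Suc k \<Rightarrow> (Bot m r # replicate k (Cnt m r)) @ [Cnt m r])"
  by (auto simp: replicate_append_same split: list.split nat.split)

text \<open>An honest letter changes each stack just as the step changes the configuration, so it
  never produces a fault.\<close>

lemma wins_enabled:
  assumes "enabled (Op m c \<beta>) (t, C)"
  shows "wins check_move (Op m c \<beta> # w) (stack i (t, C)) \<longleftrightarrow>
    wins check_move w (stack i (advance (t, C)))"
proof -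
  obtain K \<sigma> where C: "C t = (c # K, \<sigma>)" and m: "m = t" and ok: "branch_ok c \<beta> \<sigma>"
    using assms by (cases "C t") auto
  show ?thesis
  proof (cases i)
    case TurnCheck
    then show ?thesis using m by (simp add: wins_Cons_snoc[of _ _ _ "[]", simplified])
  next
    case (CtlCheck n)
    show ?thesis
    proof (cases "n = t")
      case True
      then have "stack i (t, C) = (End t # map (Ctl t) (rev K)) @ [Ctl t c]"
        using C CtlCheck by simp
      then show ?thesis
        using True C m continuation_branch_ok[OF ok] unfolding CtlCheck
        by (simp add: wins_Cons_snoc del: stack.simps append_Cons) simp
    next
      case False
      then have "stack i (advance (t, C)) = stack i (t, C)" by (simp add: CtlCheck)
      then show ?thesis
        using False m unfolding CtlCheck stack_snoc
        by (auto simp: wins_unchanged simp del: append_Cons append_Nil split: list.split)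
    qed
  next
    case (RegCheck n r)
    show ?thesis
    proof (cases "n = t")
      case True
      show ?thesis
      proof (cases "\<sigma> r")
        case 0
        then have "stack i (t, C) = [] @ [Bot t r]" using True C RegCheck by simp
        moreover have "at_zero c \<beta> r = Some (effect c \<sigma> r)"
          using 0 ok by (cases c) auto
        ultimately show ?thesis
          using True C m unfolding RegCheck
          by (simp add: wins_Cons_snoc del: append_Cons append_Nil) simp
      next
        case (Suc k)
        then have "stack i (t, C) = (Bot t r # replicate k (Cnt t r)) @ [Cnt t r]"
          using True C RegCheck by (simp add: replicate_append_same)
        moreover have "\<exists>j. at_positive c \<beta> r = Some j \<and> effect c \<sigma> r = k + j"
          using Suc ok by (cases c) auto
        then obtain j where "at_positive c \<beta> r = Some j" "effect c \<sigma> r = k + j" by blast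
        ultimately show ?thesis
          using True C m unfolding RegCheck
          by (simp add: wins_Cons_snoc del: append_Cons) (simp add: replicate_add)
      qed
    next
      case False
      then have "stack i (advance (t, C)) = stack i (t, C)" by (simp add: RegCheck)
      then show ?thesis
        using False m unfolding RegCheck stack_snoc
        by (auto simp: wins_unchanged simp del: append_Cons append_Nil split: nat.split)
    qed
  qed
qed

text \<open>Register checks come first, ordered by register, so that the goals depending on the
  inputs stand at the front of the join and its code is easy to compute.\<close>

definition checks :: "nat \<Rightarrow> check list" where
  "checks R = concat (map (\<lambda>r. [RegCheck False r, RegCheck True r]) [0..<R]) @
    [TurnCheck, CtlCheck False, CtlCheck True]"

lemma set_checks: "set (checks R) = {RegCheck m r | m r. r < R} \<union> {TurnCheck} \<union> range CtlCheck"
  by (auto simp: checks_def UNIV_bool)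

definition refuted :: "nat \<Rightarrow> letter list \<Rightarrow> config \<Rightarrow> bool" where
  "refuted R w C \<longleftrightarrow> (\<exists>i\<in>set (checks R). wins check_move w (stack i C))"

lemma refuted_enabled:
  "enabled (Op m c \<beta>) C \<Longrightarrow> refuted R (Op m c \<beta> # w) C \<longleftrightarrow> refuted R w (advance C)"
  using wins_enabled unfolding refuted_def by (cases C) blast

text \<open>One check catches the dishonest letter at once: wrong turn, command not on top of the
  control stack, or wrong branch. The bound on \<open>r\<close> ensures that the register tested by
  a loop has its check.\<close>

lemma refuted_disabled:
  assumes "\<not> enabled (Op m c \<beta>) (t, C)" "\<And>r d. c = While r d \<Longrightarrow> r < R"
  shows "refuted R (Op m c \<beta> # w) (t, C)"
proof -
  consider "m \<noteq> t" | "\<nexists>K. fst (C m) = c # K" | "\<not> branch_ok c \<beta> (snd (C m))"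
    using assms(1) by auto
  then have "\<exists>i\<in>set (checks R). \<exists>s u. stack i (t, C) = s @ [u] \<and> check_move (Op m c \<beta>) u = None"
  proof cases
    case 1
    then show ?thesis by (intro bexI[of _ TurnCheck]) (auto simp: set_checks)
  next
    case 2
    then show ?thesis
      by (intro bexI[of _ "CtlCheck m"]) (unfold stack_snoc, auto simp: set_checks split: list.split)
  next
    case 3
    then obtain r d where "c = While r d" "\<beta> \<longleftrightarrow> snd (C m) r = 0" by (cases c) auto
    then show ?thesis
      using assms(2)
      by (intro bexI[of _ "RegCheck m r"]) (unfold stack_snoc, auto simp: set_checks split: nat.split)
  qed
  then show ?thesis unfolding refuted_def by (metis wins.fault)
qed

lemma refuted_Finish: "refuted R [Finish] (t, C) \<longleftrightarrow> fst (C True) \<noteq> []"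
proof -
  have "wins check_move [Finish] (stack i (t, C)) \<longleftrightarrow> i = CtlCheck True \<and> fst (C True) \<noteq> []" for i
  proof (cases i)
    case TurnCheck
    then show ?thesis by (simp add: wins_Cons_snoc[of _ _ _ "[]", simplified])
  next
    case (CtlCheck m)
    show ?thesis
      unfolding CtlCheck stack_snoc by (cases "fst (C m)") (auto simp: wins_Cons_snoc simp del: append_Cons append_Nil)
  next
    case (RegCheck m r)
    show ?thesis
      unfolding RegCheck stack_snoc
      by (cases "snd (C m) r") (auto simp: wins_Cons_snoc simp del: append_Cons append_Nil)
  qed
  then show ?thesis by (auto simp: refuted_def set_checks)
qed

section \<open>Finite alphabets and the outcome of races\<close>

definition letters :: "cmd list \<Rightarrow> letter list" where
  "letters S = concat (map (\<lambda>c. [Op False c False, Op False c True, Op True c False, Op True c True]) S)"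

lemma set_letters: "set (letters S) = {Op m c \<beta> | m c \<beta>. c \<in> set S}"
  by (auto simp: letters_def)

definition symbols :: "cmd list \<Rightarrow> nat \<Rightarrow> sym list" where
  "symbols S R = concat (map (\<lambda>m. Turn m # End m # map (Ctl m) S @ map (Bot m) [0..<R] @
    map (Cnt m) [0..<R]) [False, True])"

lemma set_symbols:
  "set (symbols S R) = {Turn m | m. True} \<union> {End m | m. True} \<union> {Ctl m c | m c. c \<in> set S} \<union>
    {Bot m r | m r. r < R} \<union> {Cnt m r | m r. r < R}"
  by (auto simp: symbols_def)

text \<open>Only loops test registers, so the bound \<open>R\<close> concerns the registers of
  loops.\<close>

definition closed_program :: "cmd list \<Rightarrow> nat \<Rightarrow> bool" where
  "closed_program S R \<longleftrightarrow>
    (\<forall>c\<in>set S. (\<forall>\<beta>. set (continuation \<beta> c) \<subseteq> set S) \<and> (\<forall>r d. c = While r d \<longrightarrow> r < R))"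

lemma check_move_closed:
  assumes "closed_program S R" "check_move a t = Some v" "a \<in> insert Finish (set (letters S))"
    "t \<in> set (symbols S R)"
  shows "set v \<subseteq> set (symbols S R)"
proof (cases a)
  case (Op m c \<beta>)
  then have "set (continuation \<beta> c) \<subseteq> set S"
    using assms by (auto simp: closed_program_def set_letters)
  then show ?thesis
    using assms(2,4) Op by (cases t; cases m)
      (auto simp: set_symbols subset_iff ex_bool_eq all_bool_eq split: if_splits)
next
  case Finish
  then show ?thesis using assms(2,4) by (cases t) (auto split: if_splits)
qed

lemma stack_symbols:
  assumes "i \<in> set (checks R)" "\<forall>m. set (fst (C m)) \<subseteq> set S"
  shows "set (stack i (t, C)) \<subseteq> set (symbols S R)"
proof (cases i)
  case (CtlCheck m)
  then show ?thesis using assms(2)[rule_format, of m] by (auto simp: set_symbols)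
qed (use assms(1) in \<open>auto simp: set_symbols set_checks\<close>)

lemma refuted_Cons:
  assumes "closed_program S R" "a \<in> set (letters S)"
  shows "refuted R (a # w) C \<longleftrightarrow> (enabled a C \<longrightarrow> refuted R w (advance C))"
proof -
  obtain m c \<beta> where a: "a = Op m c \<beta>" "c \<in> set S" using assms(2) by (auto simp: set_letters)
  then have "\<And>r d. c = While r d \<Longrightarrow> r < R" using assms(1) by (auto simp: closed_program_def)
  then show ?thesis
    using refuted_enabled[of m c \<beta> C R w] refuted_disabled[of m c \<beta> "fst C" "snd C" R w] a
    by (cases "enabled a C") simp_all
qed

text \<open>An honest history alternates, so the first program has to move again after its
  \<open>n\<close> steps, when its control stack is empty. This rules out \<open>2 * n + 1\<close>
  letters, with one letter more if the second program moves first.\<close>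

lemma refuted_if_first_halts:
  assumes "closed_program S R" "set w \<subseteq> set (letters S)"
    and "fst ((step ^^ n) (C False)) = []" "2 * n + (if t then 2 else 1) \<le> length w"
  shows "refuted R w (t, C)"
  using assms(2-)
proof (induction w arbitrary: t C n)
  case Nil
  then show ?case by (simp split: if_splits)
next
  case (Cons a w)
  have "refuted R w (advance (t, C))" if "enabled a (t, C)"
  proof (cases t)
    case True
    then show ?thesis using Cons.prems by (auto intro!: Cons.IH[where n = n])
  next
    case False
    then obtain c K where "fst (C False) = c # K" using \<open>enabled a (t, C)\<close> by (cases a) auto
    \<comment> \<open>For \<open>n = 0\<close> the control stack would already be empty.\<close>
    then obtain n' where "n = Suc n'" using Cons.prems(2) by (cases n) auto
    then show ?thesis using False Cons.prems
      by (auto intro!: Cons.IH[where n = n'] simp: funpow_swap1)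
  qed
  then show ?case using Cons.prems by (subst refuted_Cons[OF assms(1)]) auto
qed

text \<open>Either \<open>w\<close> contains a dishonest letter, or the second program is still
  running when \<open>Finish\<close> is read.\<close>

lemma refuted_if_second_diverges:
  assumes "closed_program S R" "set w \<subseteq> set (letters S)" "\<not> halts (C True)"
  shows "refuted R (w @ [Finish]) (t, C)"
  using assms(2-)
proof (induction w arbitrary: t C)
  case Nil
  then have "fst ((step ^^ 0) (C True)) \<noteq> []" unfolding halts_def by blast
  then show ?case by (simp add: refuted_Finish)
next
  case (Cons a w)
  then have "refuted R (w @ [Finish]) (advance (t, C))"
    by (auto intro!: Cons.IH)
  then show ?case using Cons.prems by (simp add: refuted_Cons[OF assms(1)])
qed

lemma obtain_enabled:
  assumes "closed_program S R" "fst (C t) \<noteq> []" "\<forall>m. set (fst (C m)) \<subseteq> set S"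
  obtains a where "a \<in> set (letters S)" "enabled a (t, C)"
    "\<forall>m. set (fst ((C(t := step (C t))) m)) \<subseteq> set S"
proof -
  obtain c K \<sigma> where C: "C t = (c # K, \<sigma>)" using assms(2) by (cases "C t"; cases "fst (C t)") auto
  have c: "c \<in> set S" "set K \<subseteq> set S" using C assms(3)[rule_format, of t] by auto
  have "branch_ok c (branch_ok c True \<sigma>) \<sigma>" by (cases c) auto
  then have "enabled (Op t c (branch_ok c True \<sigma>)) (t, C)" using C by simp
  moreover have "\<forall>m. set (fst ((C(t := step (C t))) m)) \<subseteq> set S"
    using assms(1,3) c C by (auto simp: closed_program_def)
  moreover have "Op t c (branch_ok c True \<sigma>) \<in> set (letters S)"
    using c(1) by (auto simp: set_letters)
  ultimately show ?thesis using that by blast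
qed

text \<open>The witness is the honest history, two letters per round, broken off once the second
  program has halted. The first program never runs out of moves.\<close>

lemma unrefuted_if_second_halts:
  assumes "closed_program S R" "\<not> halts (C False)" "fst ((step ^^ n) (C True)) = []"
    "\<forall>m. set (fst (C m)) \<subseteq> set S"
  shows "\<exists>w. set w \<subseteq> set (letters S) \<and> \<not> refuted R (w @ [Finish]) (False, C)"
  using assms(2-)
proof (induction n arbitrary: C)
  case 0
  then show ?case by (intro exI[of _ "[]"]) (simp add: refuted_Finish)
next
  case (Suc n)
  show ?case
  proof (cases "fst (C True) = []")
    case True
    then show ?thesis by (intro exI[of _ "[]"]) (simp add: refuted_Finish)
  next
    case False
    have "fst ((step ^^ 0) (C False)) \<noteq> []" using Suc.prems(1) unfolding halts_def by blast
    then obtain a where a: "a \<in> set (letters S)" "enabled a (False, C)"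
        "\<forall>m. set (fst ((C(False := step (C False))) m)) \<subseteq> set S"
      using obtain_enabled[OF assms(1) _ Suc.prems(3), of False] by auto
    let ?C = "C(False := step (C False))"
    have "fst (?C True) \<noteq> []" using False by simp
    then obtain b where b: "b \<in> set (letters S)" "enabled b (True, ?C)"
        "\<forall>m. set (fst ((?C(True := step (?C True))) m)) \<subseteq> set S"
      using obtain_enabled[OF assms(1) _ a(3)] by blast
    let ?D = "?C(True := step (?C True))"
    have "\<not> halts (?D False)" "fst ((step ^^ n) (?D True)) = []"
      using Suc.prems by (simp_all add: funpow_swap1)
    from Suc.IH[OF this b(3)] obtain w
      where w: "set w \<subseteq> set (letters S)" "\<not> refuted R (w @ [Finish]) (False, ?D)" by blast
    then show ?thesis
      using a b by (intro exI[of _ "a # b # w"]) (simp add: refuted_Cons[OF assms(1)])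
  qed
qed

definition race_sequent :: "cmd list \<Rightarrow> nat \<Rightarrow> config \<Rightarrow> sequent" where
  "race_sequent S R C = game_sequent check_move (symbols S R) (letters S) Finish
    (map (\<lambda>i. stack i C) (checks R))"

lemma race_sequent_provable:
  assumes "closed_program S R" "\<forall>m. set (fst (C m)) \<subseteq> set S"
    and "halts (C False)" "\<not> halts (C True)"
  shows "derivable (base_rules \<union> act_rules) (race_sequent S R (False, C))"
proof -
  obtain n where n: "fst ((step ^^ n) (C False)) = []" using assms(3) by (auto simp: halts_def)
  show ?thesis
    unfolding race_sequent_def
  \<comment> \<open>The race starts with the first program, hence \<open>2 * n + 1\<close>
    letters.\<close>
  proof (rule game_sequent_provable[where N = "2 * n + 1"])
    show "set v \<subseteq> set (symbols S R)"
      if "check_move a t = Some v" "a \<in> insert Finish (set (letters S))" "t \<in> set (symbols S R)" for a t v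
      using check_move_closed[OF assms(1) that] .
    show "set s \<subseteq> set (symbols S R)" if "s \<in> set (map (\<lambda>i. stack i (False, C)) (checks R))" for s
      using that stack_symbols[OF _ assms(2)] by auto
    show "\<exists>s\<in>set (map (\<lambda>i. stack i (False, C)) (checks R)). wins check_move w s"
      if "set w \<subseteq> set (letters S)" "length w = 2 * n + 1" for w
      using refuted_if_first_halts[where C = C and t = False, OF assms(1) that(1) n] that(2)
      by (auto simp: refuted_def)
    show "\<exists>s\<in>set (map (\<lambda>i. stack i (False, C)) (checks R)). wins check_move (w @ [Finish]) s"
      if "set w \<subseteq> set (letters S)" for w
      using refuted_if_second_diverges[where C = C, OF assms(1) that assms(4)] by (auto simp: refuted_def)
  qed
qed

lemma race_sequent_not_derivable:
  assumes "closed_program S R" "\<forall>m. set (fst (C m)) \<subseteq> set S"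
    and "\<not> halts (C False)" "halts (C True)"
  shows "\<not> derivable ACT\<^sub>\<omega> (race_sequent S R (False, C))"
proof -
  obtain n where "fst ((step ^^ n) (C True)) = []" using assms(4) by (auto simp: halts_def)
  then obtain w where w: "set w \<subseteq> set (letters S)" "\<not> refuted R (w @ [Finish]) (False, C)"
    using unrefuted_if_second_halts[where C = C, OF assms(1,3) _ assms(2)] by blast
  show ?thesis
    using derivable_game_sequent_wins[OF _ w(1)] w(2)
    unfolding race_sequent_def refuted_def by force
qed

section \<open>Finite command sets closed under continuation\<close>

primrec subcommands :: "cmd \<Rightarrow> cmd list" where
  "subcommands Skip = [Skip]"
| "subcommands (Inc r) = [Inc r]"
| "subcommands (Dec r) = [Dec r]"
| "subcommands (Seq c d) = Seq c d # subcommands c @ subcommands d"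
| "subcommands (While r c) = While r c # subcommands c"

lemma subcommands_refl: "c \<in> set (subcommands c)"
  by (cases c) auto

lemma subcommands_continuation:
  "c \<in> set (subcommands p) \<Longrightarrow> set (continuation \<beta> c) \<subseteq> set (subcommands p)"
  by (induction p) (auto simp: subcommands_refl)

lemma obtain_closed_program:
  obtains S R where "closed_program S R" "c \<in> set S" "d \<in> set S" "3 \<le> R"
proof -
  let ?S = "subcommands c @ subcommands d"
  have "finite ((\<lambda>b. case b of While r _ \<Rightarrow> r | _ \<Rightarrow> 0) ` set ?S)" (is "finite ?F") by simp
  then obtain R where R: "\<And>r. r \<in> ?F \<Longrightarrow> r < R"
    using finite_nat_set_iff_bounded by (metis (lifting))
  have "r < R" if "While r b \<in> set ?S" for r b
    using R[of r] that by force
  \<comment> \<open>Adding 3 guarantees checks for the three input registers.\<close>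
  then have "closed_program ?S (3 + R)"
    using subcommands_continuation by (fastforce simp: closed_program_def)
  then show ?thesis using that[of ?S "3 + R"] subcommands_refl by auto
qed

subsection \<open>Computability of the sequent codes\<close>

definition recf_computable :: "nat \<Rightarrow> (nat list \<Rightarrow> nat) \<Rightarrow> bool" where
  "recf_computable n F \<longleftrightarrow> (\<exists>f. \<forall>xs. length xs = n \<longrightarrow> recf_eval f xs (F xs))"

definition defined :: "recf \<Rightarrow> nat list \<Rightarrow> bool" where
  "defined f xs \<longleftrightarrow> (\<exists>y. recf_eval f xs y)"

lemma recf_eval_RComp:
  "recf_eval (RComp f gs) xs z \<longleftrightarrow>
    (\<exists>ys. list_all2 (\<lambda>g y. recf_eval g xs y) gs ys \<and> recf_eval f ys z)"
  by (blast intro: recf_eval.comp elim: recf_eval_elims)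

lemma recf_computable_proj: "i < n \<Longrightarrow> recf_computable n (\<lambda>xs. xs ! i)"
  unfolding recf_computable_def using recf_eval.proj by blast

lemma recf_computable_comp1:
  assumes "recf_computable 1 H" "recf_computable n F"
  shows "recf_computable n (\<lambda>xs. H [F xs])"
proof -
  obtain h f where "\<And>xs. length xs = 1 \<Longrightarrow> recf_eval h xs (H xs)"
    "\<And>xs. length xs = n \<Longrightarrow> recf_eval f xs (F xs)"
    using assms unfolding recf_computable_def by blast
  then have "\<And>xs. length xs = n \<Longrightarrow> recf_eval (RComp h [f]) xs (H [F xs])"
    by (intro recf_eval.comp[where ys = "[_]"]) auto
  then show ?thesis unfolding recf_computable_def by blast
qed

lemma recf_computable_comp2:
  assumes "recf_computable 2 H" "recf_computable n F" "recf_computable n G"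
  shows "recf_computable n (\<lambda>xs. H [F xs, G xs])"
proof -
  obtain h f g where "\<And>xs. length xs = 2 \<Longrightarrow> recf_eval h xs (H xs)"
    "\<And>xs. length xs = n \<Longrightarrow> recf_eval f xs (F xs)" "\<And>xs. length xs = n \<Longrightarrow> recf_eval g xs (G xs)"
    using assms unfolding recf_computable_def by blast
  then have "\<And>xs. length xs = n \<Longrightarrow> recf_eval (RComp h [f, g]) xs (H [F xs, G xs])"
    by (intro recf_eval.comp[where ys = "[_, _]"]) auto
  then show ?thesis unfolding recf_computable_def by blast
qed

lemma recf_computable_Suc: "recf_computable n F \<Longrightarrow> recf_computable n (\<lambda>xs. Suc (F xs))"
proof -
  have "recf_computable 1 (\<lambda>xs. Suc (xs ! 0))"
    unfolding recf_computable_def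
    by (intro exI[of _ RSucc]) (auto simp: length_Suc_conv intro: recf_eval.succ)
  then show "recf_computable n F \<Longrightarrow> recf_computable n (\<lambda>xs. Suc (F xs))"
    using recf_computable_comp1[of "\<lambda>xs. Suc (xs ! 0)" n F] by simp
qed

lemma recf_computable_const: "recf_computable n (\<lambda>_. c)"
proof (induction c)
  case 0
  then show ?case unfolding recf_computable_def using recf_eval.zero by blast
next
  case (Suc c)
  then show ?case by (rule recf_computable_Suc)
qed

text \<open>Arithmetic operations only have to be rewritten with \<open>rec_nat\<close> in the first
  argument to be recognised as primitive recursions.\<close>

lemma recf_computable_rec_nat:
  assumes "recf_computable n F" "recf_computable (Suc (Suc n)) G"
  shows "recf_computable (Suc n) (\<lambda>xs. rec_nat (F (tl xs)) (\<lambda>k y. G (k # y # tl xs)) (xs ! 0))"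
proof -
  obtain f g where f: "\<And>xs. length xs = n \<Longrightarrow> recf_eval f xs (F xs)"
    and g: "\<And>xs. length xs = Suc (Suc n) \<Longrightarrow> recf_eval g xs (G xs)"
    using assms unfolding recf_computable_def by blast
  have "recf_eval (RPrim f g) (k # xs) (rec_nat (F xs) (\<lambda>k y. G (k # y # xs)) k)"
    if "length xs = n" for k xs
    using that by (induction k) (auto intro!: recf_eval.prim_0 recf_eval.prim_Suc f g)
  then have "length xs = Suc n \<Longrightarrow>
      recf_eval (RPrim f g) xs (rec_nat (F (tl xs)) (\<lambda>k y. G (k # y # tl xs)) (xs ! 0))" for xs
    by (cases xs) auto
  then show ?thesis unfolding recf_computable_def by blast
qed

lemma recf_computable_add:
  assumes "recf_computable n F" "recf_computable n G"
  shows "recf_computable n (\<lambda>xs. F xs + G xs)"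
proof -
  have "recf_computable (Suc 1)
      (\<lambda>xs. rec_nat (tl xs ! 0) (\<lambda>k y. Suc ((k # y # tl xs) ! 1)) (xs ! 0))"
    by (intro recf_computable_rec_nat recf_computable_Suc recf_computable_proj) auto
  moreover have "rec_nat b (\<lambda>k y. Suc ((k # y # zs) ! 1)) a = a + b" for a b :: nat and zs
    by (induction a) auto
  ultimately have "recf_computable 2 (\<lambda>xs. xs ! 0 + tl xs ! 0)"
    by (simp add: numeral_2_eq_2)
  from recf_computable_comp2[OF this assms] show ?thesis by simp
qed

lemma recf_computable_triangle:
  assumes "recf_computable n F"
  shows "recf_computable n (\<lambda>xs. triangle (F xs))"
proof -
  have "recf_computable (Suc 0) (\<lambda>xs. rec_nat 0
      (\<lambda>k y. (k # y # tl xs) ! 1 + Suc ((k # y # tl xs) ! 0)) (xs ! 0))"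
    by (intro recf_computable_rec_nat recf_computable_add recf_computable_Suc recf_computable_proj
        recf_computable_const) auto
  moreover have "rec_nat 0 (\<lambda>k y. (k # y # zs) ! 1 + Suc ((k # y # zs) ! 0)) a = triangle a"
    for a :: nat and zs
    by (induction a) auto
  ultimately have "recf_computable 1 (\<lambda>xs. triangle (xs ! 0))" by simp
  from recf_computable_comp1[OF this assms] show ?thesis by simp
qed

text \<open>\<open>prod_encode (m, n)\<close> unfolds to \<open>triangle (m + n) + m\<close>, so
  addition and triangular numbers suffice.\<close>

lemma recf_computable_prod_encode:
  "recf_computable n F \<Longrightarrow> recf_computable n G \<Longrightarrow> recf_computable n (\<lambda>xs. prod_encode (F xs, G xs))"
  unfolding prod_encode_def by (simp add: recf_computable_add recf_computable_triangle)

text \<open>A search whose test ignores the search variable: it stops at 0 if \<open>F\<close>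
  vanishes, and never otherwise.\<close>

lemma recf_computable_zero_domain:
  assumes "recf_computable n F"
  shows "\<exists>f. \<forall>xs. length xs = n \<longrightarrow> (defined f xs \<longleftrightarrow> F xs = 0)"
proof -
  obtain f where f: "\<And>xs. length xs = n \<Longrightarrow> recf_eval f xs (F xs)"
    using assms unfolding recf_computable_def by blast
  \<comment> \<open>The projections from 1 on drop the search variable, which \<open>RMu\<close>
    puts in front.\<close>
  let ?g = "RComp f (map RProj [1..<Suc n])"
  have g: "recf_eval ?g (m # xs) y \<longleftrightarrow> y = F xs" if xs: "length xs = n" for m xs y
  proof -
    have "list_all2 (\<lambda>g y. recf_eval g (m # xs) y) (map RProj [1..<Suc n]) xs"
      using xs recf_eval.proj[of "Suc _" "m # xs"]
      by (auto simp: list_all2_conv_all_nth simp del: upt_Suc)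
    then have "recf_eval ?g (m # xs) (F xs)" using f[OF xs] by (rule recf_eval.comp)
    then show ?thesis using recf_eval_deterministic by blast
  qed
  have "defined (RMu ?g) xs \<longleftrightarrow> F xs = 0" if xs: "length xs = n" for xs
  proof
    assume "defined (RMu ?g) xs"
    then show "F xs = 0" using g[OF xs] by (auto simp: defined_def elim: recf_eval_elims(7))
  next
    assume "F xs = 0"
    then have "recf_eval (RMu ?g) xs 0" using g[OF xs] by (intro recf_eval.mu) auto
    then show "defined (RMu ?g) xs" by (auto simp: defined_def)
  qed
  then show ?thesis by blast
qed

lemma recf_computable_pullback:
  assumes "recf_computable n F"
  shows "\<exists>g. \<forall>xs. length xs = n \<longrightarrow> (defined g xs \<longleftrightarrow> defined f [F xs])"
proof -
  obtain h where h: "\<And>xs. length xs = n \<Longrightarrow> recf_eval h xs (F xs)"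
    using assms unfolding recf_computable_def by blast
  have "defined (RComp f [h]) xs \<longleftrightarrow> defined f [F xs]" if "length xs = n" for xs
  proof -
    have "recf_eval h xs y \<longleftrightarrow> y = F xs" for y
      using h[OF that] recf_eval_deterministic by blast
    then show ?thesis by (simp add: defined_def recf_eval_RComp list_all2_Cons1)
  qed
  then show ?thesis by blast
qed

section \<open>Codes of the goals that depend on the inputs\<close>

definition reg_code :: "bool \<Rightarrow> nat \<Rightarrow> nat \<Rightarrow> nat" where
  "reg_code m r y = form_code (goal (Bot m r # replicate y (Cnt m r)))"

text \<open>Primitive recursion on the register content wraps one \<open>RDiv\<close>, tag 5, per
  counter; the bottom marker contributes the outermost division.\<close>

lemma recf_computable_reg_code:
  assumes "recf_computable n F"
  shows "recf_computable n (\<lambda>xs. reg_code m r (F xs))"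
proof -
  let ?c = "form_code (stack_var (Cnt m r))" and ?b = "form_code (stack_var (Bot m r))"
  let ?D = "\<lambda>y. form_code (rdivs answer (replicate y (stack_var (Cnt m r))))"
  have "recf_computable (Suc 0) (\<lambda>xs. rec_nat (form_code answer)
      (\<lambda>k y. prod_encode (5, prod_encode ((k # y # tl xs) ! 1, ?c))) (xs ! 0))"
    by (intro recf_computable_rec_nat recf_computable_prod_encode recf_computable_proj
        recf_computable_const) auto
  moreover have "rec_nat (form_code answer)
      (\<lambda>k y. prod_encode (5, prod_encode ((k # y # zs) ! 1, ?c))) a = ?D a" for a and zs :: "nat list"
    by (induction a) (simp_all del: form_code.simps(1))
  ultimately have "recf_computable 1 (\<lambda>xs. ?D (xs ! 0))" by simp
  from recf_computable_comp1[OF this assms] have "recf_computable n (\<lambda>xs. ?D (F xs))" by simp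
  then have "recf_computable n (\<lambda>xs. prod_encode (5, prod_encode (?D (F xs), ?b)))"
    by (intro recf_computable_prod_encode recf_computable_const)
  then show ?thesis by (simp add: reg_code_def goal_def)
qed

definition join_code :: "nat \<Rightarrow> nat \<Rightarrow> nat" where
  "join_code a b = prod_encode (6, prod_encode (a, b))"

lemma form_code_joins:
  "form_code (joins \<alpha>s \<beta>) = foldr join_code (map form_code \<alpha>s) (form_code \<beta>)"
  by (induction \<alpha>s) (simp_all add: join_code_def)

text \<open>Only \<open>l\<close> and \<open>g\<close> depend on the two programs; \<open>x\<close>, \<open>y\<close>, \<open>z\<close> are their inputs.\<close>

definition race_code :: "nat \<Rightarrow> nat \<Rightarrow> nat \<Rightarrow> nat \<Rightarrow> nat \<Rightarrow> nat" where
  "race_code l g x y z = prod_encode (l,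
    join_code (reg_code False 0 x) (join_code (reg_code True 0 x)
    (join_code (reg_code False 1 y) (join_code (reg_code True 1 y)
    (join_code (reg_code False 2 z) (join_code (reg_code True 2 z) g))))))"

lemma recf_computable_race_code:
  assumes "recf_computable n L" "recf_computable n G"
    "recf_computable n X" "recf_computable n Y" "recf_computable n Z"
  shows "recf_computable n (\<lambda>xs. race_code (L xs) (G xs) (X xs) (Y xs) (Z xs))"
  unfolding race_code_def join_code_def
  by (intro recf_computable_prod_encode recf_computable_reg_code recf_computable_const assms)

subsection \<open>Diagonalisation\<close>

lemma checks_split:
  assumes "3 \<le> R"
  shows "checks R = [RegCheck False 0, RegCheck True 0, RegCheck False 1, RegCheck True 1,
      RegCheck False 2, RegCheck True 2] @
    concat (map (\<lambda>r. [RegCheck False r, RegCheck True r]) [3..<R]) @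
    [TurnCheck, CtlCheck False, CtlCheck True]"
proof -
  have "[0..<R] = [0, 1, 2] @ [3..<R]"
    using assms by (simp add: upt_conv_Cons numeral_eq_Suc)
  then show ?thesis by (simp add: checks_def)
qed

text \<open>The inputs enter the sequent only through the initial register stacks, so its code is a
  fixed computable function of the program data \<open>l\<close>, \<open>g\<close> and the
  inputs.\<close>

lemma race:
  shows "\<exists>l g. \<forall>x y z. \<exists>s. sequent_code s = race_code l g x y z \<and>
    (defined f\<^sub>1 [x, y, z] \<longrightarrow> \<not> defined f\<^sub>2 [x, y, z] \<longrightarrow> s \<in> ACT_join) \<and>
    (\<not> defined f\<^sub>1 [x, y, z] \<longrightarrow> defined f\<^sub>2 [x, y, z] \<longrightarrow> s \<notin> ACT\<^sub>\<omega>_join)"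
proof -
  \<comment> \<open>Arguments in registers 0, 1, 2, the result in 3, scratch space from 4
    on.\<close>
  define p where "p m = compile (if m then f\<^sub>2 else f\<^sub>1) [0, 1, 2] 3 4" for m
  obtain S R where S: "closed_program S R" "p False \<in> set S" "p True \<in> set S" and R: "3 \<le> R"
    by (rule obtain_closed_program)
  define \<sigma> where "\<sigma> x y z = (\<lambda>r. if r < 3 then [x, y, z] ! r else 0)" for x y z :: nat
  define C where "C x y z = (\<lambda>m. ([p m], \<sigma> x y z))" for x y z
  define rest where "rest = concat (map (\<lambda>r. [RegCheck False r, RegCheck True r]) [3..<R]) @
    [TurnCheck, CtlCheck False, CtlCheck True]"
  \<comment> \<open>The inputs \<open>0 0 0\<close> are placeholders: neither the left side nor the
    goals from \<open>rest\<close> depend on them.\<close>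
  define l where "l = list_encode (map form_code (fst (race_sequent S R (False, C 0 0 0))))"
  define g where
    "g = form_code (joins (map (\<lambda>i. goal (stack i (False, C 0 0 0))) rest) Zero)"
  have halts: "halts (C x y z m) \<longleftrightarrow> defined (if m then f\<^sub>2 else f\<^sub>1) [x, y, z]" for x y z m
  proof -
    have A: "map (\<sigma> x y z) [0, 1, 2] = [x, y, z]" by (simp add: \<sigma>_def numeral_eq_Suc)
    have B: "exec (p m) (\<sigma> x y z) \<tau> \<longleftrightarrow> (\<exists>v. recf_eval (if m then f\<^sub>2 else f\<^sub>1)
        (map (\<sigma> x y z) [0, 1, 2]) v \<and> \<tau> = (\<sigma> x y z)(3 := v))" for \<tau>
      unfolding p_def
      by (intro computesD[OF computes_compile]) (auto simp: \<sigma>_def free_above_def)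
    show ?thesis unfolding C_def halts_iff_exec defined_def B A by blast
  qed
  have code: "sequent_code (race_sequent S R (False, C x y z)) = race_code l g x y z" for x y z
  proof -
    \<comment> \<open>\<open>rest\<close> inspects the turn, the control stacks and registers from 3
      on, which start empty.\<close>
    have rest_eq: "stack i (False, C x y z) = stack i (False, C 0 0 0)" if "i \<in> set rest" for i
      using that by (auto simp: rest_def C_def \<sigma>_def)
    have "snd (race_sequent S R (False, C x y z)) =
      joins (map (\<lambda>i. goal (stack i (False, C x y z))) (checks R)) Zero"
      by (simp add: race_sequent_def game_sequent_def comp_def)
    also have "\<dots> = joins (map goal
        [Bot False 0 # replicate x (Cnt False 0), Bot True 0 # replicate x (Cnt True 0),
         Bot False 1 # replicate y (Cnt False 1), Bot True 1 # replicate y (Cnt True 1),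
         Bot False 2 # replicate z (Cnt False 2), Bot True 2 # replicate z (Cnt True 2)])
        (joins (map (\<lambda>i. goal (stack i (False, C x y z))) rest) Zero)"
      unfolding checks_split[OF R] rest_def[symmetric] by (simp add: C_def \<sigma>_def)
    also have "map (\<lambda>i. goal (stack i (False, C x y z))) rest =
        map (\<lambda>i. goal (stack i (False, C 0 0 0))) rest"
      by (simp add: rest_eq)
    finally have snd_eq: "form_code (snd (race_sequent S R (False, C x y z))) = foldr join_code (map form_code (map goal
        [Bot False 0 # replicate x (Cnt False 0), Bot True 0 # replicate x (Cnt True 0),
         Bot False 1 # replicate y (Cnt False 1), Bot True 1 # replicate y (Cnt True 1),
         Bot False 2 # replicate z (Cnt False 2), Bot True 2 # replicate z (Cnt True 2)])) g"
      unfolding g_def by (simp only: form_code_joins[symmetric])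
    have "list_encode (map form_code (fst (race_sequent S R (False, C x y z)))) = l"
      by (simp add: l_def race_sequent_def game_sequent_def)
    then show ?thesis
      unfolding sequent_code_def snd_eq by (simp add: race_code_def reg_code_def)
  qed
  have within: "\<forall>m. set (fst (C x y z m)) \<subseteq> set S" for x y z
  proof
    show "set (fst (C x y z m)) \<subseteq> set S" for m
      using S(2,3) by (cases m) (simp_all add: C_def)
  qed
  have meet_free: "meet_free (race_sequent S R (False, C x y z))" for x y z
    unfolding race_sequent_def by (rule meet_free_game_sequent)
  show ?thesis
  proof (rule exI[of _ l], rule exI[of _ g], intro allI exI conjI impI)
    fix x y z
    show "sequent_code (race_sequent S R (False, C x y z)) = race_code l g x y z"
      by (rule code)
    show "race_sequent S R (False, C x y z) \<in> ACT_join"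
      if "defined f\<^sub>1 [x, y, z]" "\<not> defined f\<^sub>2 [x, y, z]"
      using race_sequent_provable[where C = "C x y z", OF S(1) within] that
      by (simp add: halts meet_free ACT_join_def)
    show "race_sequent S R (False, C x y z) \<notin> ACT\<^sub>\<omega>_join"
      if "\<not> defined f\<^sub>1 [x, y, z]" "defined f\<^sub>2 [x, y, z]"
      using race_sequent_not_derivable[where C = "C x y z", OF S(1) within] that
      by (simp add: halts ACT\<^sub>\<omega>_join_def)
  qed
qed

theorem theorem6:
  fixes L :: "sequent set"
  assumes "\<And>s. s \<in> L \<Longrightarrow> meet_free s"
    and "ACT_join \<subseteq> L"
    and "L \<subseteq> ACT\<^sub>\<omega>_join"
  shows "\<not> decidable L \<and> (recursively_enumerable L \<longrightarrow> sigma1_complete L)"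
proof -
  define A where "A = sequent_code ` L"
  \<comment> \<open>Self-reference: \<open>G [l, g, z]\<close> codes the race whose first two inputs
    are its own \<open>l\<close> and \<open>g\<close>.\<close>
  define G where "G xs = race_code (xs ! 0) (xs ! 1) (xs ! 0) (xs ! 1) (xs ! 2)" for xs :: "nat list"
  have G: "recf_computable 3 G"
    unfolding G_def by (intro recf_computable_race_code recf_computable_proj) auto
  have diagonal: "\<exists>l g. \<forall>z.
      (defined f\<^sub>1 [l, g, z] \<longrightarrow> \<not> defined f\<^sub>2 [l, g, z] \<longrightarrow> G [l, g, z] \<in> A) \<and>
      (\<not> defined f\<^sub>1 [l, g, z] \<longrightarrow> defined f\<^sub>2 [l, g, z] \<longrightarrow> G [l, g, z] \<notin> A)" for f\<^sub>1 f\<^sub>2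
  proof -
    obtain l g where lg: "\<forall>x y z. \<exists>s. sequent_code s = race_code l g x y z \<and>
      (defined f\<^sub>1 [x, y, z] \<longrightarrow> \<not> defined f\<^sub>2 [x, y, z] \<longrightarrow> s \<in> ACT_join) \<and>
      (\<not> defined f\<^sub>1 [x, y, z] \<longrightarrow> defined f\<^sub>2 [x, y, z] \<longrightarrow> s \<notin> ACT\<^sub>\<omega>_join)"
      using race[of f\<^sub>1 f\<^sub>2] by (elim exE)
    show ?thesis
    proof (rule exI[of _ l], rule exI[of _ g], rule allI)
      fix z
      obtain s where s: "sequent_code s = G [l, g, z]"
        "defined f\<^sub>1 [l, g, z] \<longrightarrow> \<not> defined f\<^sub>2 [l, g, z] \<longrightarrow> s \<in> ACT_join"
        "\<not> defined f\<^sub>1 [l, g, z] \<longrightarrow> defined f\<^sub>2 [l, g, z] \<longrightarrow> s \<notin> ACT\<^sub>\<omega>_join"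
        using lg[rule_format, of l g z] by (auto simp: G_def)
      have "G [l, g, z] \<in> A \<longleftrightarrow> s \<in> L"
        unfolding s(1)[symmetric] A_def by (rule inj_image_mem_iff[OF inj_sequent_code])
      then show "(defined f\<^sub>1 [l, g, z] \<longrightarrow> \<not> defined f\<^sub>2 [l, g, z] \<longrightarrow> G [l, g, z] \<in> A) \<and>
          (\<not> defined f\<^sub>1 [l, g, z] \<longrightarrow> defined f\<^sub>2 [l, g, z] \<longrightarrow> G [l, g, z] \<notin> A)"
        using s(2,3) subsetD[OF assms(2), of s] subsetD[OF assms(3), of s] by argo
    qed
  qed
  have "\<not> decidable L"
  proof
    assume "decidable L"
    then obtain f where f: "\<And>n. recf_eval f [n] (if n \<in> A then 1 else 0)"
      unfolding decidable_def decidable_set_def computable_def A_def by auto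
    have "recf_eval f xs (if xs ! 0 \<in> A then 1 else 0)" if "length xs = 1" for xs
      using that f[of "xs ! 0"] by (cases xs) simp_all
    then have "recf_computable 1 (\<lambda>xs. if xs ! 0 \<in> A then 1 else 0)"
      unfolding recf_computable_def by (intro exI[of _ f] allI impI)
    from recf_computable_comp1[OF this G]
    have F: "recf_computable 3 (\<lambda>xs. if G xs \<in> A then 1 else 0)" by simp
    \<comment> \<open>\<open>f\<^sub>1\<close> halts iff the code is outside \<open>A\<close>, and
      \<open>f\<^sub>2\<close> below iff it is inside. Exactly one of them halts, and the race then
      forces the opposite membership.\<close>
    obtain f\<^sub>1 where f\<^sub>1: "\<forall>xs. length xs = 3 \<longrightarrow>
        (defined f\<^sub>1 xs \<longleftrightarrow> (if G xs \<in> A then 1 else 0) = (0 :: nat))"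
      using recf_computable_zero_domain[OF F] ..
    \<comment> \<open>This recursion exchanges 0 and 1 and so complements the test.\<close>
    have "recf_computable (Suc 0) (\<lambda>xs. rec_nat 1 (\<lambda>k y. 0) (xs ! 0))"
      by (intro recf_computable_rec_nat recf_computable_const)
    from recf_computable_comp1[OF this[folded One_nat_def] F]
    have "recf_computable 3 (\<lambda>xs. rec_nat 1 (\<lambda>k y. 0) (if G xs \<in> A then 1 else 0))" by simp
    from recf_computable_zero_domain[OF this] obtain f\<^sub>2 where f\<^sub>2: "\<forall>xs. length xs = 3 \<longrightarrow>
        (defined f\<^sub>2 xs \<longleftrightarrow> rec_nat 1 (\<lambda>k y. 0) (if G xs \<in> A then 1 else 0 :: nat) = (0 :: nat))" ..
    obtain l g where "\<forall>z. (defined f\<^sub>1 [l, g, z] \<longrightarrow> \<not> defined f\<^sub>2 [l, g, z] \<longrightarrow> G [l, g, z] \<in> A) \<and>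
      (\<not> defined f\<^sub>1 [l, g, z] \<longrightarrow> defined f\<^sub>2 [l, g, z] \<longrightarrow> G [l, g, z] \<notin> A)"
      using diagonal[of f\<^sub>1 f\<^sub>2] by (elim exE)
    from this[rule_format, of 0] show False using f\<^sub>1[rule_format, of "[l, g, 0]"] f\<^sub>2[rule_format, of "[l, g, 0]"]
      by (auto split: if_splits)
  qed
  moreover have "many_one_reducible B A" if L: "recursively_enumerable L" and "re_set B" for B
  proof -
    obtain b where b: "B = {n. defined b [n]}"
      using \<open>re_set B\<close> unfolding re_set_def defined_def by blast
    obtain a where a: "A = {n. defined a [n]}"
      using L unfolding recursively_enumerable_def re_set_def defined_def A_def by auto
    \<comment> \<open>\<open>f\<^sub>1\<close> semi-decides membership of the third input in
      \<open>B\<close>; \<open>f\<^sub>2\<close> semi-decides whether the code of the race itself is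
      in \<open>A\<close>.\<close>
    have "recf_computable 3 (\<lambda>xs. xs ! 2)" by (intro recf_computable_proj) simp
    from recf_computable_pullback[OF this, of b] obtain f\<^sub>1
      where f\<^sub>1: "\<forall>xs. length xs = 3 \<longrightarrow> (defined f\<^sub>1 xs \<longleftrightarrow> defined b [xs ! 2])" ..
    from recf_computable_pullback[OF G, of a] obtain f\<^sub>2
      where f\<^sub>2: "\<forall>xs. length xs = 3 \<longrightarrow> (defined f\<^sub>2 xs \<longleftrightarrow> defined a [G xs])" ..
    obtain l g where lg: "\<forall>z. (defined f\<^sub>1 [l, g, z] \<longrightarrow> \<not> defined f\<^sub>2 [l, g, z] \<longrightarrow> G [l, g, z] \<in> A) \<and>
      (\<not> defined f\<^sub>1 [l, g, z] \<longrightarrow> defined f\<^sub>2 [l, g, z] \<longrightarrow> G [l, g, z] \<notin> A)"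
      using diagonal[of f\<^sub>1 f\<^sub>2] by (elim exE)
    have "n \<in> B \<longleftrightarrow> G [l, g, n] \<in> A" for n
    proof -
      have "defined f\<^sub>1 [l, g, n] \<longleftrightarrow> n \<in> B" "defined f\<^sub>2 [l, g, n] \<longleftrightarrow> G [l, g, n] \<in> A"
        using f\<^sub>1 f\<^sub>2 by (simp_all add: a b)
      \<comment> \<open>If the two memberships differed, exactly one program would halt, and the
        race would force the membership of \<open>G [l, g, n]\<close> to be the opposite.\<close>
      then show ?thesis using lg[rule_format, of n] by argo
    qed
    moreover have "computable (\<lambda>n. G [l, g, n])"
    proof -
      have "recf_computable 1 (\<lambda>xs. race_code l g l g (xs ! 0))"
        by (intro recf_computable_race_code recf_computable_const recf_computable_proj) simp
      then obtain h where h: "\<And>xs. length xs = 1 \<Longrightarrow> recf_eval h xs (race_code l g l g (xs ! 0))"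
        unfolding recf_computable_def by auto
      have "recf_eval h [n] (G [l, g, n])" for n
        using h[of "[n]"] by (simp add: G_def)
      then show ?thesis unfolding computable_def by (intro exI[of _ h] allI)
    qed
    ultimately show ?thesis
      unfolding many_one_reducible_def by (intro exI[of _ "\<lambda>n. G [l, g, n]"] conjI allI)
  qed
  ultimately show ?thesis
    unfolding sigma1_complete_def sigma1_complete_set_def recursively_enumerable_def A_def
    by auto
qed

end
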